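(* Let $L$ be a countable signature of continuous logic, let $F$ be a fragment of the infinitary continuous logic $\mathcal{L}_{\omega_1\omega}(L)$, and let $T$ be an $F$-theory all of whose models are almost locally compact. Then the isomorphism relation $\cong_T$ on $\mathrm{Mod}(T)$ is classifiable by countable structures.
   Context: A Polish metric structure in signature $L$ is a complete separable metric space $(M,d)$ (with bounded metric) together with interpretations of the predicate symbols of $L$ as uniformly continuous real-valued functions with the moduli prescribed by $L$. As in the paper, fragments are countable. $\mathrm{Mod}(L)$ denotes the standard Borel space of codes of Polish metric structures: a code describes the values of $d$ and of all predicates on tuples from $\mathbb{N}$, where $\mathbb{N}$ is a tail-dense subset of the structure (every tail $\{n,n+1,\dots\}$ is dense); the coded structure is the completion. An $F$-theory $T$ is a set of $F$-sentences, and $\mathrm{Mod}(T)\subseteq \mathrm{Mod}(L)$ is the set of codes of structures in which every sentence of $T$ takes value $0$. For $M,N\in\mathrm{Mod}(T)$, $M\cong_T N$ iff the coded structures are isomorphic (there is a surjective isometry preserving all predicates). A topological space is almost locally compact if it contains a dense locally compact subspace. An equivalence relation $E$ on a standard Borel space $X$ is classifiable by countable structures if there are a countable relational language $L'$ and a Borel map $f$ from $X$ into the standard Borel space of $L'$-structures with universe $\mathbb{N}$ such that $xEy$ iff $f(x)\cong f(y)$. *)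

theory Defs
  imports "HOL-Analysis.Analysis" "HOL-Probability.Probability"
begin

record signature =
  Preds   :: "nat set"
  arity   :: "nat \<Rightarrow> nat"
  modulus :: "nat \<Rightarrow> real \<Rightarrow> real"
  pbound  :: "nat \<Rightarrow> real"

definition signature_ok :: "signature \<Rightarrow> bool" where
  "signature_ok L \<longleftrightarrow> (\<forall>p\<in>Preds L. \<forall>\<epsilon>>0. modulus L p \<epsilon> > 0)"

record 'u mstruc =
  carrier :: "'u set"
  mdst    :: "'u \<Rightarrow> 'u \<Rightarrow> real"
  mpred   :: "nat \<Rightarrow> 'u list \<Rightarrow> real"

definition mtop :: "'u mstruc \<Rightarrow> 'u topology" where
  "mtop M = Metric_space.mtopology (carrier M) (mdst M)"

definition metric_structure :: "signature \<Rightarrow> 'u mstruc \<Rightarrow> bool" where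
  "metric_structure L M \<longleftrightarrow>
     Metric_space (carrier M) (mdst M) \<and> carrier M \<noteq> {} \<and>
     (\<exists>B. \<forall>x\<in>carrier M. \<forall>y\<in>carrier M. mdst M x y \<le> B) \<and>
     (\<forall>p\<in>Preds L. \<forall>as. set as \<subseteq> carrier M \<and> length as = arity L p
         \<longrightarrow> \<bar>mpred M p as\<bar> \<le> pbound L p) \<and>
     (\<forall>p\<in>Preds L. \<forall>\<epsilon>>0. \<forall>as bs.
        set as \<subseteq> carrier M \<and> set bs \<subseteq> carrier M \<and>
        length as = arity L p \<and> length bs = arity L p \<and>
        (\<forall>k<arity L p. mdst M (as ! k) (bs ! k) < modulus L p \<epsilon>)
        \<longrightarrow> \<bar>mpred M p as - mpred M p bs\<bar> \<le> \<epsilon>)"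

definition polish_structure :: "signature \<Rightarrow> 'u mstruc \<Rightarrow> bool" where
  "polish_structure L M \<longleftrightarrow> metric_structure L M \<and>
     Metric_space.mcomplete (carrier M) (mdst M) \<and> separable_space (mtop M)"

text \<open>Fixed universe type for structures (cardinality of the continuum, enough
  to carry every Polish structure up to isomorphism).\<close>
type_synonym univ = "nat \<Rightarrow> real"

datatype form =
    Dist nat nat
  | Pred nat "nat list"
  | Conn "real list \<Rightarrow> real" "form list"
  | SupQ nat form
  | InfQ nat form
  | BigSup "nat \<Rightarrow> form"
  | BigInf "nat \<Rightarrow> form"

primrec fv :: "form \<Rightarrow> nat set" where
  "fv (Dist i j) = {i, j}"
| "fv (Pred p is) = set is"
| "fv (Conn u \<phi>s) = \<Union> (set (map fv \<phi>s))"
| "fv (SupQ i \<phi>) = fv \<phi> - {i}"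
| "fv (InfQ i \<phi>) = fv \<phi> - {i}"
| "fv (BigSup \<phi>s) = (\<Union>n. fv (\<phi>s n))"
| "fv (BigInf \<phi>s) = (\<Union>n. fv (\<phi>s n))"

primrec eval :: "form \<Rightarrow> 'u mstruc \<Rightarrow> (nat \<Rightarrow> 'u) \<Rightarrow> real" where
  "eval (Dist i j) M \<sigma> = mdst M (\<sigma> i) (\<sigma> j)"
| "eval (Pred p is) M \<sigma> = mpred M p (map \<sigma> is)"
| "eval (Conn u \<phi>s) M \<sigma> = u (map (\<lambda>\<phi>. eval \<phi> M \<sigma>) \<phi>s)"
| "eval (SupQ i \<phi>) M \<sigma> = (SUP a\<in>carrier M. eval \<phi> M (\<sigma>(i := a)))"
| "eval (InfQ i \<phi>) M \<sigma> = (INF a\<in>carrier M. eval \<phi> M (\<sigma>(i := a)))"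
| "eval (BigSup \<phi>s) M \<sigma> = (SUP n. eval (\<phi>s n) M \<sigma>)"
| "eval (BigInf \<phi>s) M \<sigma> = (INF n. eval (\<phi>s n) M \<sigma>)"

definition continuous_conn :: "nat \<Rightarrow> (real list \<Rightarrow> real) \<Rightarrow> bool" where
  "continuous_conn n u \<longleftrightarrow> (\<forall>x. length x = n \<longrightarrow> (\<forall>\<epsilon>>0. \<exists>\<delta>>0. \<forall>y. length y = n \<and>
      (\<forall>k<n. \<bar>x ! k - y ! k\<bar> < \<delta>) \<longrightarrow> \<bar>u x - u y\<bar> < \<epsilon>))"

definition uniform_family :: "signature \<Rightarrow> (nat \<Rightarrow> form) \<Rightarrow> bool" where
  "uniform_family L \<phi>s \<longleftrightarrow> finite (\<Union>n. fv (\<phi>s n)) \<and>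
     (\<exists>B \<Delta>. (\<forall>\<epsilon>>0. \<Delta> \<epsilon> > (0::real)) \<and>
        (\<forall>(M::univ mstruc). metric_structure L M \<longrightarrow>
           (\<forall>n \<sigma>. range \<sigma> \<subseteq> carrier M \<longrightarrow> \<bar>eval (\<phi>s n) M \<sigma>\<bar> \<le> B) \<and>
           (\<forall>n \<sigma> \<tau> \<epsilon>. range \<sigma> \<subseteq> carrier M \<and> range \<tau> \<subseteq> carrier M \<and> \<epsilon> > 0 \<and>
              (\<forall>i\<in>(\<Union>m. fv (\<phi>s m)). mdst M (\<sigma> i) (\<tau> i) < \<Delta> \<epsilon>)
              \<longrightarrow> \<bar>eval (\<phi>s n) M \<sigma> - eval (\<phi>s n) M \<tau>\<bar> \<le> \<epsilon>)))"

inductive wff :: "signature \<Rightarrow> form \<Rightarrow> bool" for L where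
  "wff L (Dist i j)"
| "p \<in> Preds L \<Longrightarrow> length is = arity L p \<Longrightarrow> wff L (Pred p is)"
| "continuous_conn (length \<phi>s) u \<Longrightarrow> (\<forall>\<phi>\<in>set \<phi>s. wff L \<phi>) \<Longrightarrow> wff L (Conn u \<phi>s)"
| "wff L \<phi> \<Longrightarrow> wff L (SupQ i \<phi>)"
| "wff L \<phi> \<Longrightarrow> wff L (InfQ i \<phi>)"
| "(\<forall>n. wff L (\<phi>s n)) \<Longrightarrow> uniform_family L \<phi>s \<Longrightarrow> wff L (BigSup \<phi>s)"
| "(\<forall>n. wff L (\<phi>s n)) \<Longrightarrow> uniform_family L \<phi>s \<Longrightarrow> wff L (BigInf \<phi>s)"

primrec imm_subforms :: "form \<Rightarrow> form set" where
  "imm_subforms (Dist i j) = {}"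
| "imm_subforms (Pred p is) = {}"
| "imm_subforms (Conn u \<phi>s) = set \<phi>s"
| "imm_subforms (SupQ i \<phi>) = {\<phi>}"
| "imm_subforms (InfQ i \<phi>) = {\<phi>}"
| "imm_subforms (BigSup \<phi>s) = range \<phi>s"
| "imm_subforms (BigInf \<phi>s) = range \<phi>s"

definition fragment :: "signature \<Rightarrow> form set \<Rightarrow> bool" where
  "fragment L F \<longleftrightarrow> countable F \<and> F \<subseteq> {\<phi>. wff L \<phi>} \<and>
     (\<forall>i j. Dist i j \<in> F) \<and>
     (\<forall>p\<in>Preds L. \<forall>is. length is = arity L p \<longrightarrow> Pred p is \<in> F) \<and>
     (\<forall>\<phi>\<in>F. imm_subforms \<phi> \<subseteq> F) \<and>
     (\<forall>\<phi>\<in>F. \<forall>i. SupQ i \<phi> \<in> F \<and> InfQ i \<phi> \<in> F)"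

definition sentence :: "form \<Rightarrow> bool" where
  "sentence \<phi> \<longleftrightarrow> fv \<phi> = {}"

definition models :: "'u mstruc \<Rightarrow> form set \<Rightarrow> bool" where
  "models M T \<longleftrightarrow> (\<forall>\<phi>\<in>T. \<forall>\<sigma>. range \<sigma> \<subseteq> carrier M \<longrightarrow> eval \<phi> M \<sigma> = 0)"

type_synonym code = "(nat \<times> nat + nat \<times> nat list) \<Rightarrow> real"

definition codes :: "signature \<Rightarrow> code \<Rightarrow> 'u mstruc \<Rightarrow> (nat \<Rightarrow> 'u) \<Rightarrow> bool" where
  "codes L c M e \<longleftrightarrow> polish_structure L M \<and> range e \<subseteq> carrier M \<and>
     (\<forall>k. (mtop M) closure_of (e ` {k..}) = carrier M) \<and>
     (\<forall>m n. c (Inl (m, n)) = mdst M (e m) (e n)) \<and>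
     (\<forall>p is. c (Inr (p, is)) =
        (if p \<in> Preds L \<and> length is = arity L p then mpred M p (map e is) else 0))"

definition Mod_L :: "signature \<Rightarrow> code set" where
  "Mod_L L = {c. \<exists>(M::univ mstruc) e. codes L c M e}"

definition Mod_T :: "signature \<Rightarrow> form set \<Rightarrow> code set" where
  "Mod_T L T = {c \<in> Mod_L L. \<exists>(M::univ mstruc) e. codes L c M e \<and> models M T}"

definition iso_struc :: "signature \<Rightarrow> 'u mstruc \<Rightarrow> 'v mstruc \<Rightarrow> bool" where
  "iso_struc L M N \<longleftrightarrow> (\<exists>f. bij_betw f (carrier M) (carrier N) \<and>
     (\<forall>x\<in>carrier M. \<forall>y\<in>carrier M. mdst N (f x) (f y) = mdst M x y) \<and>
     (\<forall>p\<in>Preds L. \<forall>as. set as \<subseteq> carrier M \<and> length as = arity L p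
        \<longrightarrow> mpred N p (map f as) = mpred M p as))"

definition iso_T :: "signature \<Rightarrow> form set \<Rightarrow> code \<Rightarrow> code \<Rightarrow> bool" where
  "iso_T L T c c' \<longleftrightarrow> c \<in> Mod_T L T \<and> c' \<in> Mod_T L T \<and>
     (\<exists>(M::univ mstruc) e (N::univ mstruc) e'. codes L c M e \<and> codes L c' N e' \<and> iso_struc L M N)"

definition almost_locally_compact :: "'a topology \<Rightarrow> bool" where
  "almost_locally_compact X \<longleftrightarrow>
     (\<exists>D. D \<subseteq> topspace X \<and> X closure_of D = topspace X \<and> locally_compact_space (subtopology X D))"

text \<open>Countable structures in a countable relational language (relation symbol i
  has arity ar i) with universe N, coded as elements of the standard Borel space
  of functions (nat \<times> nat list) \<Rightarrow> bool (only tuples of the right length matter).\<close>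
definition ctbl_iso :: "(nat \<Rightarrow> nat) \<Rightarrow> (nat \<times> nat list \<Rightarrow> bool) \<Rightarrow> (nat \<times> nat list \<Rightarrow> bool) \<Rightarrow> bool" where
  "ctbl_iso ar A B \<longleftrightarrow> (\<exists>\<pi>. bij \<pi> \<and>
     (\<forall>i xs. length xs = ar i \<longrightarrow> (A (i, xs) \<longleftrightarrow> B (i, map \<pi> xs))))"

definition classifiable_by_countable_structures :: "'a measure \<Rightarrow> ('a \<Rightarrow> 'a \<Rightarrow> bool) \<Rightarrow> bool" where
  "classifiable_by_countable_structures X E \<longleftrightarrow>
     (\<exists>(ar :: nat \<Rightarrow> nat) (f :: 'a \<Rightarrow> nat \<times> nat list \<Rightarrow> bool).
        f \<in> measurable X (PiM UNIV (\<lambda>_. count_space UNIV)) \<and>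
        (\<forall>x\<in>space X. \<forall>y\<in>space X. E x y \<longleftrightarrow> ctbl_iso ar (f x) (f y)))"

end

theory Submission
  imports Defs
begin

text \<open>
  A code of a structure \<open>M\<close> is turned into a countable structure whose elements are canonical open sets of finite tuples of
  \<open>M\<close>: sets given by rational conditions on distances and predicates, and their components under
  chains with steps of size less than \<open>\<eta>\<close>. Being open, each of these sets is seen by every dense
  sequence, so the structure is an isomorphism invariant.

  Conversely, let \<open>\<pi>\<close> be an isomorphism between the structures of \<open>M\<close> and \<open>N\<close>, and let \<open>x\<close> be a
  dense sequence of points of \<open>M\<close> with totally bounded balls. Total boundedness and chain
  connectedness give canonical sets \<open>C\<^sub>n\<close> around the initial segments of \<open>x\<close> that settle: no point
  of \<open>C\<^sub>n\<close> has to move far in its first \<open>n\<close> coordinates to reach any other canonical set around \<open>x\<close>.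
  This property is inherited by the sets \<open>\<pi> C\<^sub>n\<close>, so one can choose points in them that converge to a
  sequence \<open>y\<close> of \<open>N\<close> with the same distances and predicates as \<open>x\<close>. Total boundedness along chains in
  \<open>N\<close> shows that \<open>y\<close> is dense, and \<open>x \<mapsto> y\<close> extends to an isomorphism.
\<close>

text \<open>An isomorphism \<open>\<pi>\<close> of invariants moves sets, not points, and is only
  known to respect the relations in \<open>link\<close>; intersections, inclusions and the
  constructors of \<open>cyl\<close> may be lost. So each fact meant for \<open>N\<close> must be
  phrased as a \<open>link_rel\<close> between two canonical sets. This is why chains appear. Total
  boundedness by itself settles only those members of a set that lie near a given tuple, and
  nearness to a tuple cannot be transported. Restricting to a chain component makes the conclusion
  hold on a whole set. A chain may be arbitrarily long, so the error must not grow from link to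
  link; \<open>Shadow\<close> is made for that, with its radius 2\<eta> and its error \<eta>. The
  density of \<open>y\<close> uses the same device in the other direction. A chain component in
  \<open>N\<close> comes from a canonical set of \<open>M\<close> of which only nonemptiness is
  known, so \<open>y\<close> is first seen to approach some point of the component; total
  boundedness then leads along the chain to the chosen base point. Almost local compactness gives
  totally bounded balls only around a dense set of points, so \<open>x\<close> and the base points
  are taken from such points.\<close>

definition near :: "('x \<Rightarrow> 'x \<Rightarrow> real) \<Rightarrow> real \<Rightarrow> 'x list \<Rightarrow> 'x list \<Rightarrow> bool" where
  "near d s = list_all2 (\<lambda>a b. d a b < s)"

lemma near_length: "near d s x y \<Longrightarrow> length x = length y"
  by (auto simp: near_def list_all2_lengthD)

lemma near_iff: "near d s x y \<longleftrightarrow> length x = length y \<and> (\<forall>i<length x. d (x!i) (y!i) < s)"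
  by (simp add: near_def list_all2_conv_all_nth)

lemma near_mono: "near d s x y \<Longrightarrow> s \<le> t \<Longrightarrow> near d t x y"
  by (fastforce simp: near_iff)

lemma near_take: "near d s x y \<Longrightarrow> near d s (take j x) (take j y)"
  by (simp add: near_def list_all2_takeI)

lemma near_map: "near d s (map e x) (map e y) \<longleftrightarrow> near (\<lambda>m n. d (e m) (e n)) s x y"
  by (simp add: near_def list_all2_map1 list_all2_map2)

lemma near_margin:
  assumes "near d s x y" "s > l"
  shows "\<exists>h. l < of_rat h \<and> of_rat h < s \<and> near d (of_rat h) x y"
proof -
  \<comment> \<open>Inserting \<open>l\<close> gives the maximum a meaning for empty tuples and
    keeps the rational above \<open>l\<close>.\<close>
  define m where "m = Max (insert l ((\<lambda>i. d (x!i) (y!i)) ` {..<length x}))"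
  have "m < s" "l \<le> m"
    using assms unfolding m_def by (auto simp: near_iff)
  then obtain h where h: "m < of_rat h" "of_rat h < s" using of_rat_dense by blast
  have "d (x!i) (y!i) \<le> m" if "i < length x" for i
    unfolding m_def using that by (intro Max_ge) auto
  then have "near d (of_rat h) x y" using assms h by (fastforce simp: near_iff)
  then show ?thesis using h \<open>l \<le> m\<close> by (intro exI[of _ h]) auto
qed

lemma near_nth_map: "near d s u v \<Longrightarrow> \<forall>i\<in>set is. i < length u \<Longrightarrow> near d s (map ((!) u) is) (map ((!) v) is)"
  by (auto simp: near_iff)

lemma take_eq_map_nth: "j \<le> length x \<Longrightarrow> take j x = map ((!) x) [0..<j]"
  by (simp add: list_eq_iff_nth_eq)

lemma rat_between:
  fixes x y :: real assumes "x < y" obtains q where "x < of_rat q" "of_rat q < y"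
  using of_rat_dense[OF assms] by blast

section \<open>Canonical sets and the relations between them\<close>

text \<open>
  The strict inequalities \<open>r < r'\<close>, \<open>s' < s\<close>, \<open>h < \<eta>\<close> hidden in the interpretations below leave a
  margin: it makes the sets open, and it makes quantification over the space equivalent to
  quantification over a dense sequence.
\<close>
datatype cond =
    DistLt nat nat rat
  | DistGt nat nat rat
  | PredLt nat "nat list" rat
  | PredGt nat "nat list" rat
  | Cover nat nat rat rat
  | TotBdd nat rat

text \<open>\<open>Shadow\<close> and \<open>Chain\<close> serve \<open>settle\<close>.
  \<open>Pull\<close> moves a condition on the first coordinate to position \<open>i\<close>, so
  that it can be met by a late entry of a sequence. \<open>Chain\<close> names its component by the
  indices of a base point, which keeps the type countable.\<close>

datatype cyl =
    Basic cond
  | Meet cyl cyl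
  | Shadow nat rat cyl cyl
  | Chain cyl rat "nat list"
  | Pull nat cyl

text \<open>Inclusion of one open set in another cannot be read off a dense sequence, which may miss
  the points where it fails; inclusion in the closure can, hence \<open>InCl\<close>.
  \<open>Near\<close> allows different positions on the two sides in order to compare entry
  \<open>k\<close> of one tuple with the first entry of another.\<close>

datatype link = Near "nat list" "nat list" rat | InCl cond

instance cond :: countable by countable_datatype
instance cyl :: countable by countable_datatype
instance link :: countable by countable_datatype

text \<open>Finite nets are lists and the mesh is rational, so that over the index set all
  quantifiers are countable; Borel measurability depends on this.\<close>

definition tb_ball :: "'x set \<Rightarrow> ('x \<Rightarrow> 'x \<Rightarrow> real) \<Rightarrow> 'x \<Rightarrow> real \<Rightarrow> bool" where
  "tb_ball X d x r \<longleftrightarrow> (\<forall>s>0. \<exists>F. set F \<subseteq> X \<and>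
     (\<forall>y\<in>X. d y x < r \<longrightarrow> (\<exists>f\<in>set F. d y f < of_rat s)))"

primrec cond_set :: "'x set \<Rightarrow> ('x \<Rightarrow> 'x \<Rightarrow> real) \<Rightarrow> (nat \<Rightarrow> 'x list \<Rightarrow> real) \<Rightarrow> cond \<Rightarrow> 'x list set" where
  "cond_set X d P (DistLt i j q) =
     {x\<in>lists X. i < length x \<and> j < length x \<and> d (x!i) (x!j) < of_rat q}"
| "cond_set X d P (DistGt i j q) =
     {x\<in>lists X. i < length x \<and> j < length x \<and> d (x!i) (x!j) > of_rat q}"
| "cond_set X d P (PredLt p is q) =
     {x\<in>lists X. (\<forall>i\<in>set is. i < length x) \<and> P p (map ((!) x) is) < of_rat q}"
| "cond_set X d P (PredGt p is q) =
     {x\<in>lists X. (\<forall>i\<in>set is. i < length x) \<and> P p (map ((!) x) is) > of_rat q}"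
| "cond_set X d P (Cover k i r s) =
     {x\<in>lists X. k \<le> length x \<and> i < length x \<and> (\<exists>r' s'. r < r' \<and> s' < s \<and>
        (\<forall>y\<in>X. d y (x!i) < of_rat r' \<longrightarrow> (\<exists>l<k. d y (x!l) < of_rat s')))}"
| "cond_set X d P (TotBdd i r) =
     {x\<in>lists X. i < length x \<and> (\<exists>r'>r. tb_ball X d (x!i) (of_rat r'))}"

text \<open>The bounds in \<open>Shadow\<close> fit one link of a chain: if \<open>x\<close> is
  within \<eta> of a tuple and \<open>u\<close> is a chain neighbour of that tuple, then
  \<open>u\<close> is within 2\<eta> of \<open>x\<close>, and hence again within \<eta> of
  \<open>S\<close>. The sequence \<open>e\<close> enters only through the base point of
  \<open>Chain\<close>.\<close>

primrec cyl_set :: "'x set \<Rightarrow> ('x \<Rightarrow> 'x \<Rightarrow> real) \<Rightarrow> (nat \<Rightarrow> 'x list \<Rightarrow> real) \<Rightarrow> (nat \<Rightarrow> 'x) \<Rightarrow> cyl \<Rightarrow> 'x list set" where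
  "cyl_set X d P e (Basic \<beta>) = cond_set X d P \<beta>"
| "cyl_set X d P e (Meet C S) = cyl_set X d P e C \<inter> cyl_set X d P e S"
| "cyl_set X d P e (Shadow j \<eta> C S) =
     {x\<in>cyl_set X d P e S. j \<le> length x \<and> (\<exists>r h. 2 * \<eta> < r \<and> h < \<eta> \<and>
        (\<forall>u\<in>cyl_set X d P e C. j \<le> length u \<and> near d (of_rat r) (take j x) (take j u) \<longrightarrow>
           (\<exists>v\<in>cyl_set X d P e S. j \<le> length v \<and> near d (of_rat h) (take j u) (take j v))))}"
| "cyl_set X d P e (Chain C \<eta> a) =
     {x\<in>lists X. 0 < \<eta> \<and> length a \<le> length x \<and> map e a \<in> cyl_set X d P e C \<and>
        (map e a, take (length a) x) \<in>
          {(u, v). u \<in> cyl_set X d P e C \<and> v \<in> cyl_set X d P e C \<and> near d (of_rat \<eta>) u v}\<^sup>*}"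
| "cyl_set X d P e (Pull i C) =
     {x\<in>lists X. i < length x \<and> (\<exists>u\<in>cyl_set X d P e C. u \<noteq> [] \<and> hd u = x!i)}"

primrec link_rel :: "'x set \<Rightarrow> ('x \<Rightarrow> 'x \<Rightarrow> real) \<Rightarrow> (nat \<Rightarrow> 'x list \<Rightarrow> real) \<Rightarrow> link \<Rightarrow> 'x list set \<Rightarrow> 'x list set \<Rightarrow> bool" where
  "link_rel X d P (Near is js \<eta>) A B \<longleftrightarrow> (\<exists>h<\<eta>. \<forall>u\<in>A. (\<forall>i\<in>set is. i < length u) \<longrightarrow>
     (\<exists>v\<in>B. (\<forall>j\<in>set js. j < length v) \<and> near d (of_rat h) (map ((!) u) is) (map ((!) v) js)))"
| "link_rel X d P (InCl \<beta>) A B \<longleftrightarrow> (\<forall>u\<in>A. \<forall>s>0. \<exists>v\<in>cond_set X d P \<beta>. near d (of_rat s) u v)"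

section \<open>Openness of canonical sets\<close>

text \<open>Distinct points may have distance 0: besides the structure itself, the index set of a
  dense sequence is an instance, and there points may be repeated.\<close>

locale pms =
  fixes X :: "'x set" and d :: "'x \<Rightarrow> 'x \<Rightarrow> real" and P :: "nat \<Rightarrow> 'x list \<Rightarrow> real"
  assumes d_refl: "x \<in> X \<Longrightarrow> d x x = 0"
    and d_sym: "x \<in> X \<Longrightarrow> y \<in> X \<Longrightarrow> d x y = d y x"
    and d_tri: "x \<in> X \<Longrightarrow> y \<in> X \<Longrightarrow> z \<in> X \<Longrightarrow> d x z \<le> d x y + d y z"
    and P_cont: "xs \<in> lists X \<Longrightarrow> \<epsilon> > 0 \<Longrightarrow>
      \<exists>s>0. \<forall>ys\<in>lists X. near d s xs ys \<longrightarrow> \<bar>P p xs - P p ys\<bar> < \<epsilon>"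
begin

lemma d_nonneg: "x \<in> X \<Longrightarrow> y \<in> X \<Longrightarrow> 0 \<le> d x y"
  using d_tri[of x y x] d_refl[of x] d_sym[of x y] by simp

lemma near_refl: "x \<in> lists X \<Longrightarrow> 0 < s \<Longrightarrow> near d s x x"
  by (auto simp: near_iff d_refl in_lists_conv_set)

lemma near_sym: "x \<in> lists X \<Longrightarrow> y \<in> lists X \<Longrightarrow> near d s x y \<Longrightarrow> near d s y x"
  by (auto simp: near_iff in_lists_conv_set d_sym)

lemma near_tri: "x \<in> lists X \<Longrightarrow> y \<in> lists X \<Longrightarrow> z \<in> lists X \<Longrightarrow> near d s x y \<Longrightarrow> near d t y z \<Longrightarrow> near d (s + t) x z"
  unfolding near_iff in_lists_conv_set
  by clarsimp (smt (verit) d_tri nth_mem)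

text \<open>This is openness in the disjoint union of the finite powers of \<open>X\<close>, as near
  tuples have equal length.\<close>

definition open_lists :: "'x list set \<Rightarrow> bool" where
  "open_lists A \<longleftrightarrow> A \<subseteq> lists X \<and> (\<forall>x\<in>A. \<exists>s>0. \<forall>y\<in>lists X. near d s x y \<longrightarrow> y \<in> A)"

lemma open_listsD: "open_lists A \<Longrightarrow> x \<in> A \<Longrightarrow> \<exists>s>0. \<forall>y\<in>lists X. near d s x y \<longrightarrow> y \<in> A"
  by (simp add: open_lists_def)

lemma open_cond_set: "open_lists (cond_set X d P \<beta>)"
proof -
  have A: "\<exists>s>0. \<forall>y\<in>lists X. near d s x y \<longrightarrow> \<bar>d (x!i) (x!j) - d (y!i) (y!j)\<bar> < \<epsilon>"
    if "x \<in> lists X" "i < length x" "j < length x" "\<epsilon> > 0" for x i j and \<epsilon> :: real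
  proof (intro exI conjI ballI impI)
    fix y assume y: "y \<in> lists X" "near d (\<epsilon>/2) x y"
    have m: "x!i \<in> X" "x!j \<in> X" "y!i \<in> X" "y!j \<in> X"
      using that y near_length[OF y(2)] by (auto simp: in_lists_conv_set)
    have "d (x!i) (y!i) < \<epsilon>/2" "d (x!j) (y!j) < \<epsilon>/2"
      using y that by (auto simp: near_iff)
    then show "\<bar>d (x!i) (x!j) - d (y!i) (y!j)\<bar> < \<epsilon>"
      using d_tri[of "x!i" "y!i" "x!j"] d_tri[of "y!i" "y!j" "x!j"]
        d_tri[of "y!i" "x!i" "y!j"] d_tri[of "x!i" "x!j" "y!j"] m d_sym by (smt (verit) field_sum_of_halves)
  qed (use that in simp)
  have B: "\<exists>s>0. \<forall>y\<in>lists X. near d s x y \<longrightarrow> \<bar>P p (map ((!) x) is) - P p (map ((!) y) is)\<bar> < \<epsilon>"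
    if "x \<in> lists X" "\<forall>i\<in>set is. i < length x" "\<epsilon> > 0" for x p "is" and \<epsilon> :: real
  proof -
    have "map ((!) x) is \<in> lists X" using that by (auto simp: in_lists_conv_set)
    from P_cont[OF this that(3), of p] obtain s where s: "s > 0"
      "\<And>ys. ys \<in> lists X \<Longrightarrow> near d s (map ((!) x) is) ys \<Longrightarrow> \<bar>P p (map ((!) x) is) - P p ys\<bar> < \<epsilon>" by blast
    show ?thesis
    proof (intro exI[of _ s] conjI ballI impI)
      fix y assume y: "y \<in> lists X" "near d s x y"
      have "map ((!) y) is \<in> lists X" using that y near_length[OF y(2)] by (auto simp: in_lists_conv_set)
      then show "\<bar>P p (map ((!) x) is) - P p (map ((!) y) is)\<bar> < \<epsilon>"
        using s(2) near_nth_map[OF y(2) that(2)] by blast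
    qed (rule s)
  qed
  have sub: "cond_set X d P \<beta> \<subseteq> lists X" by (cases \<beta>) auto
  have "\<exists>s>0. \<forall>y\<in>lists X. near d s x y \<longrightarrow> y \<in> cond_set X d P \<beta>" if x: "x \<in> cond_set X d P \<beta>" for x
  proof (cases \<beta>)
    case (DistLt i j q)
    then obtain s where "s > 0" "\<forall>y\<in>lists X. near d s x y \<longrightarrow> \<bar>d (x!i) (x!j) - d (y!i) (y!j)\<bar> < of_rat q - d (x!i) (x!j)"
      using A[of x i j "of_rat q - d (x!i) (x!j)"] x by auto
    then show ?thesis using x DistLt by (intro exI[of _ s]) (fastforce dest: near_length)
  next
    case (DistGt i j q)
    then obtain s where "s > 0" "\<forall>y\<in>lists X. near d s x y \<longrightarrow> \<bar>d (x!i) (x!j) - d (y!i) (y!j)\<bar> < d (x!i) (x!j) - of_rat q"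
      using A[of x i j "d (x!i) (x!j) - of_rat q"] x by auto
    then show ?thesis using x DistGt by (intro exI[of _ s]) (fastforce dest: near_length)
  next
    case (PredLt p "is" q)
    then obtain s where "s > 0" "\<forall>y\<in>lists X. near d s x y \<longrightarrow> \<bar>P p (map ((!) x) is) - P p (map ((!) y) is)\<bar> < of_rat q - P p (map ((!) x) is)"
      using B[of x "is" "of_rat q - P p (map ((!) x) is)" p] x by auto
    then show ?thesis using x PredLt by (intro exI[of _ s]) (fastforce dest: near_length)
  next
    case (PredGt p "is" q)
    then obtain s where "s > 0" "\<forall>y\<in>lists X. near d s x y \<longrightarrow> \<bar>P p (map ((!) x) is) - P p (map ((!) y) is)\<bar> < P p (map ((!) x) is) - of_rat q"
      using B[of x "is" "P p (map ((!) x) is) - of_rat q" p] x by auto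
    then show ?thesis using x PredGt by (intro exI[of _ s]) (fastforce dest: near_length)
  next
    case (Cover k i r t)
    then obtain r' t' where *: "x \<in> lists X" "k \<le> length x" "i < length x" "r < r'" "t' < t"
      "\<And>y. y \<in> X \<Longrightarrow> d y (x!i) < of_rat r' \<Longrightarrow> \<exists>l<k. d y (x!l) < of_rat t'"
      using x by auto
    obtain r2 t2 where rt: "r < r2" "r2 < r'" "t' < t2" "t2 < t" using * dense by metis
    \<comment> \<open>Moving the entries by less than \<open>s\<close> costs r' - r2 at the centre
      of the ball and t2 - t' at the covering points.\<close>
    define s where "s = min (of_rat r' - of_rat r2 :: real) (of_rat t2 - of_rat t')"
    have "s > 0" using rt by (simp add: s_def of_rat_less)
    moreover have "y \<in> cond_set X d P \<beta>" if y: "y \<in> lists X" "near d s x y" for y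
    proof -
      have len: "length y = length x" using y near_length by metis
      have m: "x!l \<in> X" "y!l \<in> X" "d (x!l) (y!l) < s" if "l < length x" for l
        using y * len that by (auto simp: in_lists_conv_set near_iff)
      have "\<exists>l<k. d z (y!l) < of_rat t2" if z: "z \<in> X" "d z (y!i) < of_rat r2" for z
      proof -
        have "d z (x!i) \<le> d z (y!i) + d (y!i) (x!i)" using z m[OF *(3)] d_tri by blast
        then have "d z (x!i) < of_rat r'" using z m[OF *(3)] d_sym[of "x!i" "y!i"] by (simp add: s_def)
        then obtain l where l: "l < k" "d z (x!l) < of_rat t'" using * z by blast
        then have "l < length x" using * by simp
        then have "d z (y!l) < of_rat t2" using m[of l] d_tri[of z "x!l" "y!l"] l z by (simp add: s_def)
        then show ?thesis using l by blast
      qed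
      then show ?thesis using y * rt len Cover by auto
    qed
    ultimately show ?thesis by blast
  next
    case (TotBdd i r)
    then obtain r' where *: "x \<in> lists X" "i < length x" "r < r'" "tb_ball X d (x!i) (of_rat r')"
      using x by auto
    obtain r2 where rt: "r < r2" "r2 < r'" using * dense by metis
    define s where "s = (of_rat r' - of_rat r2 :: real)"
    have "s > 0" using rt by (simp add: s_def of_rat_less)
    moreover have "y \<in> cond_set X d P \<beta>" if y: "y \<in> lists X" "near d s x y" for y
    proof -
      have len: "length y = length x" using y near_length by metis
      have m: "x!i \<in> X" "y!i \<in> X" "d (x!i) (y!i) < s"
        using y * len by (auto simp: in_lists_conv_set near_iff)
      have "d z (x!i) < of_rat r'" if "z \<in> X" "d z (y!i) < of_rat r2" for z
        using that m d_tri[of z "y!i" "x!i"] d_sym[of "x!i" "y!i"] by (simp add: s_def)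
      then have "tb_ball X d (y!i) (of_rat r2)" using *(4) unfolding tb_ball_def by meson
      then show ?thesis using y * rt len TotBdd by auto
    qed
    ultimately show ?thesis by blast
  qed
  then show ?thesis using sub by (simp add: open_lists_def)
qed

lemma cond_set_append: "x \<in> cond_set X d P \<beta> \<Longrightarrow> y \<in> lists X \<Longrightarrow> x @ y \<in> cond_set X d P \<beta>"
proof (cases \<beta>)
  case (Cover k i r s)
  assume "x \<in> cond_set X d P \<beta>" "y \<in> lists X"
  then show ?thesis using Cover by (auto simp: nth_append) (meson order_less_le_trans)
qed (auto simp: nth_append cong: map_cong)

end

lemma near_rtrancl_length:
  "(u, v) \<in> {(u, v). u \<in> A \<and> v \<in> A \<and> near d s u v}\<^sup>* \<Longrightarrow> length v = length u"
  by (induction rule: rtrancl_induct) (auto dest: near_length)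

lemma near_rtrancl_mem:
  "(u, v) \<in> {(u, v). u \<in> A \<and> v \<in> A \<and> near d s u v}\<^sup>* \<Longrightarrow> u \<in> A \<Longrightarrow> v \<in> A"
  by (induction rule: rtrancl_induct) auto

context pms begin

lemma open_cyl_set: "open_lists (cyl_set X d P e C)"
proof (induction C)
  case (Basic \<beta>) then show ?case by (simp add: open_cond_set)
next
  case (Meet C S)
  show ?case unfolding open_lists_def
  proof (intro conjI ballI)
    fix x assume x: "x \<in> cyl_set X d P e (Meet C S)"
    obtain s t where "s > 0" "t > 0" "\<forall>y\<in>lists X. near d s x y \<longrightarrow> y \<in> cyl_set X d P e C"
      "\<forall>y\<in>lists X. near d t x y \<longrightarrow> y \<in> cyl_set X d P e S"
      using Meet x open_listsD by (metis IntE cyl_set.simps(2))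
    then show "\<exists>s>0. \<forall>y\<in>lists X. near d s x y \<longrightarrow> y \<in> cyl_set X d P e (Meet C S)"
      by (intro exI[of _ "min s t"]) (simp, meson min.cobounded1 min.cobounded2 near_mono)
  qed (use Meet in \<open>auto simp: open_lists_def\<close>)
next
  case (Shadow j \<eta> C S)
  show ?case unfolding open_lists_def
  proof (intro conjI ballI)
    fix x assume x: "x \<in> cyl_set X d P e (Shadow j \<eta> C S)"
    then have xX: "x \<in> lists X" using Shadow by (auto simp: open_lists_def)
    from x obtain r h where *: "x \<in> cyl_set X d P e S" "j \<le> length x" "2 * \<eta> < r" "h < \<eta>"
      "\<And>u. u \<in> cyl_set X d P e C \<Longrightarrow> j \<le> length u \<Longrightarrow> near d (of_rat r) (take j x) (take j u) \<Longrightarrow>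
           (\<exists>v\<in>cyl_set X d P e S. j \<le> length v \<and> near d (of_rat h) (take j u) (take j v))" by auto
    obtain r2 where r2: "2 * \<eta> < r2" "r2 < r" using * dense by blast
    obtain s where s: "s > 0" "\<And>y. y \<in> lists X \<Longrightarrow> near d s x y \<Longrightarrow> y \<in> cyl_set X d P e S"
      using Shadow(2) * open_listsD by meson
    define t where "t = min s (of_rat r - of_rat r2)"
    have "t > 0" using s r2 by (simp add: t_def of_rat_less)
    moreover have "y \<in> cyl_set X d P e (Shadow j \<eta> C S)" if y: "y \<in> lists X" "near d t x y" for y
    proof -
      have yS: "y \<in> cyl_set X d P e S" using s y near_mono[of d t x y s] by (simp add: t_def)
      have len: "length y = length x" using y near_length by metis
      have "\<exists>v\<in>cyl_set X d P e S. j \<le> length v \<and> near d (of_rat h) (take j u) (take j v)"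
        if u: "u \<in> cyl_set X d P e C" "j \<le> length u" "near d (of_rat r2) (take j y) (take j u)" for u
      proof -
        have uX: "u \<in> lists X" using u Shadow by (auto simp: open_lists_def)
        have "near d (t + of_rat r2) (take j x) (take j u)"
          by (rule near_tri[OF _ _ _ near_take[OF y(2)] u(3)]) (use xX y uX in \<open>auto simp: in_lists_conv_set dest: in_set_takeD\<close>)
        then have "near d (of_rat r) (take j x) (take j u)" by (rule near_mono) (simp add: t_def)
        then show ?thesis using * u by blast
      qed
      then show ?thesis using yS * r2 len by auto
    qed
    ultimately show "\<exists>s>0. \<forall>y\<in>lists X. near d s x y \<longrightarrow> y \<in> cyl_set X d P e (Shadow j \<eta> C S)" by blast
  qed (use Shadow in \<open>auto simp: open_lists_def\<close>)
next
  case (Chain C \<eta> a)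
  let ?R = "{(u, v). u \<in> cyl_set X d P e C \<and> v \<in> cyl_set X d P e C \<and> near d (of_rat \<eta>) u v}"
  show ?case unfolding open_lists_def
  proof (intro conjI ballI)
    fix x assume x: "x \<in> cyl_set X d P e (Chain C \<eta> a)"
    let ?k = "length a"
    have *: "x \<in> lists X" "?k \<le> length x" "map e a \<in> cyl_set X d P e C" "(map e a, take ?k x) \<in> ?R\<^sup>*" "0 < \<eta>"
      using x by auto
    have tx: "take ?k x \<in> cyl_set X d P e C" using near_rtrancl_mem[OF *(4,3)] .
    obtain s where s: "s > 0" "\<And>y. y \<in> lists X \<Longrightarrow> near d s (take ?k x) y \<Longrightarrow> y \<in> cyl_set X d P e C"
      using Chain tx open_listsD by meson
    define t where "t = min s (of_rat \<eta>)"
    have "t > 0" using s * by (simp add: t_def)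
    moreover have "y \<in> cyl_set X d P e (Chain C \<eta> a)" if y: "y \<in> lists X" "near d t x y" for y
    proof -
      have n: "near d t (take ?k x) (take ?k y)" using near_take y by blast
      have tyX: "take ?k y \<in> lists X" using y by (auto simp: in_lists_conv_set dest: in_set_takeD)
      have "take ?k y \<in> cyl_set X d P e C" using s(2)[OF tyX] near_mono[OF n, of s] by (simp add: t_def)
      then have "(take ?k x, take ?k y) \<in> ?R" using tx near_mono[OF n, of "of_rat \<eta>"] by (simp add: t_def)
      then have "(map e a, take ?k y) \<in> ?R\<^sup>*" using *(4) by (rule rtrancl_into_rtrancl[rotated])
      then show ?thesis using * y near_length[OF y(2)] by auto
    qed
    ultimately show "\<exists>s>0. \<forall>y\<in>lists X. near d s x y \<longrightarrow> y \<in> cyl_set X d P e (Chain C \<eta> a)" by blast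
  qed auto
next
  case (Pull i C)
  show ?case unfolding open_lists_def
  proof (intro conjI ballI)
    fix x assume x: "x \<in> cyl_set X d P e (Pull i C)"
    then obtain u where u: "x \<in> lists X" "i < length x" "u \<in> cyl_set X d P e C" "u \<noteq> []" "hd u = x!i" by auto
    then obtain w where w: "u = x!i # w" by (cases u) auto
    obtain s where s: "s > 0" "\<And>y. y \<in> lists X \<Longrightarrow> near d s u y \<Longrightarrow> y \<in> cyl_set X d P e C"
      using Pull u open_listsD by meson
    have uX: "u \<in> lists X" using u Pull by (auto simp: open_lists_def)
    have "y \<in> cyl_set X d P e (Pull i C)" if y: "y \<in> lists X" "near d s x y" for y
    proof -
      have "y!i \<in> X" "d (x!i) (y!i) < s" "i < length y"
        using y u near_length[OF y(2)] by (auto simp: in_lists_conv_set near_iff)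
      moreover have "near d s w w" using near_refl uX w s by auto
      ultimately have "y!i # w \<in> cyl_set X d P e C" using s uX w by (simp add: near_def)
      then show ?thesis using y \<open>i < length y\<close> by (auto intro!: bexI[of _ "y!i # w"])
    qed
    then show "\<exists>s>0. \<forall>y\<in>lists X. near d s x y \<longrightarrow> y \<in> cyl_set X d P e (Pull i C)" using s by blast
  qed auto
qed

lemma cyl_set_lists: "x \<in> cyl_set X d P e C \<Longrightarrow> x \<in> lists X"
  using open_cyl_set by (auto simp: open_lists_def)

lemma take_lists: "x \<in> lists X \<Longrightarrow> take j x \<in> lists X"
  by (auto simp: in_lists_conv_set dest: in_set_takeD)

text \<open>Each constructor looks only at coordinates that it names and that must already be
  present. Hence a set containing one initial segment of a sequence contains all longer
  ones.\<close>

lemma cyl_set_append: "x \<in> cyl_set X d P e C \<Longrightarrow> y \<in> lists X \<Longrightarrow> x @ y \<in> cyl_set X d P e C"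
proof (induction C arbitrary: x)
  case (Basic \<beta>) then show ?case by (simp add: cond_set_append)
next
  case (Shadow j \<eta> C S) then show ?case by simp
qed (auto simp: nth_append)

end

section \<open>Traces of canonical sets on a dense sequence\<close>

locale dense_pms = pms X d P for X :: "'x set" and d P +
  fixes e :: "nat \<Rightarrow> 'x"
  assumes e_mem: "e n \<in> X"
    and e_dense: "x \<in> X \<Longrightarrow> 0 < s \<Longrightarrow> \<exists>n. d x (e n) < s"
begin

abbreviation "di \<equiv> \<lambda>m n. d (e m) (e n)"
abbreviation "Pi' \<equiv> \<lambda>p is. P p (map e is)"

lemma map_e_lists: "map e ns \<in> lists X"
  using e_mem by auto

lemma approx_list: "x \<in> lists X \<Longrightarrow> 0 < s \<Longrightarrow> \<exists>ns. near d s x (map e ns)"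
proof (induction x)
  case Nil then show ?case by (intro exI[of _ "[]"]) (simp add: near_def)
next
  case (Cons a x)
  then obtain n ns where "d a (e n) < s" "near d s x (map e ns)" using e_dense[of a s] by auto
  then show ?case by (intro exI[of _ "n # ns"]) (simp add: near_def)
qed

lemma approx_open:
  assumes "open_lists A" "x \<in> A" "0 < s"
  obtains ns where "near d s x (map e ns)" "map e ns \<in> A"
proof -
  obtain t where "t > 0" "\<forall>y\<in>lists X. near d t x y \<longrightarrow> y \<in> A" using assms open_listsD by meson
  moreover obtain ns where "near d (min s t) x (map e ns)"
    using approx_list[of x "min s t"] assms calculation by (auto simp: open_lists_def)
  ultimately show ?thesis using that near_mono map_e_lists by (metis min.cobounded1 min.cobounded2)
qed

text \<open>A code is exactly this space on indices, so canonical sets can be computed from the code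
  without choosing a structure.\<close>

sublocale idx: pms UNIV di Pi'
proof
  fix xs :: "nat list" and \<epsilon> :: real and p assume "\<epsilon> > 0"
  from P_cont[OF map_e_lists this, of xs p] show "\<exists>s>0. \<forall>ys\<in>lists UNIV. near di s xs ys \<longrightarrow> \<bar>P p (map e xs) - P p (map e ys)\<bar> < \<epsilon>"
    using map_e_lists by (auto simp: near_map)
qed (use e_mem d_refl d_sym d_tri in auto)

lemma tb_ball_idx1:
  assumes "tb_ball UNIV di n r" shows "tb_ball X d (e n) r"
  unfolding tb_ball_def
proof (intro allI impI)
  fix s :: rat assume s: "0 < s"
  then have "s / 2 > 0" by simp
  then obtain F where F: "\<And>m. d (e m) (e n) < r \<Longrightarrow> \<exists>f\<in>set F. d (e m) (e f) < of_rat (s/2)"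
    using assms unfolding tb_ball_def by (metis UNIV_I)
  show "\<exists>F. set F \<subseteq> X \<and> (\<forall>y\<in>X. d y (e n) < r \<longrightarrow> (\<exists>f\<in>set F. d y f < of_rat s))"
  proof (intro exI[of _ "map e F"] conjI ballI impI)
    fix y assume y: "y \<in> X" "d y (e n) < r"
    define t where "t = min (r - d y (e n)) (of_rat (s/2))"
    have "t > 0" using y s by (simp add: t_def)
    then obtain m where m: "d y (e m) < t" using e_dense y by blast
    then have "d (e m) (e n) < r" using d_tri[of "e m" y "e n"] d_sym[of y "e m"] y e_mem by (simp add: t_def)
    then obtain f where f: "f \<in> set F" "d (e m) (e f) < of_rat (s/2)" using F by blast
    have "d y (e f) < of_rat (s/2) + of_rat (s/2)" using d_tri[of y "e m" "e f"] m f y e_mem by (simp add: t_def)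
    then have "d y (e f) < of_rat s" by (metis field_sum_of_halves of_rat_add)
    then show "\<exists>f\<in>set (map e F). d y f < of_rat s" using f by auto
  qed (use e_mem in auto)
qed

lemma tb_ball_idx2:
  assumes "tb_ball X d (e n) r" shows "tb_ball UNIV di n r"
  unfolding tb_ball_def
proof (intro allI impI)
  fix s :: rat assume s: "0 < s"
  then have "s / 2 > 0" by simp
  then obtain F where F: "set F \<subseteq> X" "\<And>m. m \<in> X \<Longrightarrow> d m (e n) < r \<Longrightarrow> \<exists>f\<in>set F. d m f < of_rat (s/2)"
    using assms unfolding tb_ball_def by metis
  obtain G where G: "near d (of_rat (s/2)) F (map e G)" using approx_list[of F "of_rat (s/2)"] F s by auto
  show "\<exists>F. set F \<subseteq> UNIV \<and> (\<forall>y\<in>UNIV. di y n < r \<longrightarrow> (\<exists>f\<in>set F. di y f < of_rat s))"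
  proof (intro exI[of _ G] conjI ballI impI)
    fix m assume "di m n < r"
    then obtain f where f: "f \<in> set F" "d (e m) f < of_rat (s/2)" using F e_mem by blast
    then obtain i where i: "i < length F" "f = F!i" by (metis in_set_conv_nth)
    then have g: "d f (e (G!i)) < of_rat (s/2)" "i < length G" using G by (auto simp: near_iff)
    have "d (e m) (e (G!i)) < of_rat (s/2) + of_rat (s/2)" using d_tri[of "e m" f "e (G!i)"] g f e_mem F by auto
    then have "d (e m) (e (G!i)) < of_rat s" by (metis field_sum_of_halves of_rat_add)
    then show "\<exists>f\<in>set G. di m f < of_rat s" using g by auto
  qed simp
qed

lemma trace_cond: "ns \<in> cond_set UNIV di Pi' \<beta> \<longleftrightarrow> map e ns \<in> cond_set X d P \<beta>"
proof (cases \<beta>)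
  case (PredLt p "is" q)
  then show ?thesis using e_mem by (auto simp: o_def cong: map_cong)
next
  case (PredGt p "is" q)
  then show ?thesis using e_mem by (auto simp: o_def cong: map_cong)
next
  case (TotBdd i r)
  then show ?thesis using e_mem tb_ball_idx1 tb_ball_idx2 by auto
next
  case (Cover k i r s)
  show ?thesis
  proof
    assume "ns \<in> cond_set UNIV di Pi' \<beta>"
    then obtain r' s' where *: "k \<le> length ns" "i < length ns" "r < r'" "s' < s"
      "\<And>y. di y (ns!i) < of_rat r' \<Longrightarrow> \<exists>l<k. di y (ns!l) < of_rat s'" using Cover by auto
    obtain s2 where s2: "s' < s2" "s2 < s" using * dense by blast
    have "\<exists>l<k. d y (map e ns!l) < of_rat s2" if y: "y \<in> X" "d y (map e ns ! i) < of_rat r'" for y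
    proof -
      define t where "t = min (of_rat r' - d y (map e ns!i)) (of_rat s2 - of_rat s')"
      have "t > 0" using y s2 by (simp add: t_def of_rat_less)
      then obtain m where m: "d y (e m) < t" using e_dense y by blast
      then have "di m (ns!i) < of_rat r'" using d_tri[of "e m" y "e (ns!i)"] d_sym[of y "e m"] y e_mem *(2) by (simp add: t_def)
      then obtain l where l: "l < k" "di m (ns!l) < of_rat s'" using * by blast
      then have "d y (e (ns!l)) < of_rat s2" using d_tri[of y "e m" "e (ns!l)"] m y e_mem by (simp add: t_def)
      then show ?thesis using l * by auto
    qed
    then show "map e ns \<in> cond_set X d P \<beta>" using * s2 Cover e_mem by auto
  next
    assume "map e ns \<in> cond_set X d P \<beta>"
    then obtain r' s' where *: "k \<le> length ns" "i < length ns" "r < r'" "s' < s"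
      "\<And>y. y \<in> X \<Longrightarrow> d y (map e ns!i) < of_rat r' \<Longrightarrow> \<exists>l<k. d y (map e ns!l) < of_rat s'" using Cover by auto
    have "\<exists>l<k. di y (ns!l) < of_rat s'" if y: "di y (ns!i) < of_rat r'" for y
    proof -
      obtain l where "l < k" "d (e y) (map e ns!l) < of_rat s'" using *(5)[of "e y"] *(2) y e_mem by auto
      then show ?thesis using * by auto
    qed
    then show "ns \<in> cond_set UNIV di Pi' \<beta>" using * Cover by auto
  qed
qed (use e_mem in auto)

end

context dense_pms begin

abbreviation "I \<equiv> cyl_set UNIV di Pi' (\<lambda>n. n)"
abbreviation "J \<equiv> cyl_set X d P e"

text \<open>A chain is moved link by link into the dense sequence, openness of \<open>A\<close>
  keeping the new tuples in \<open>A\<close>. As \<open>v\<close> itself need not be indexed, the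
  induction must reach every indexed tuple close to \<open>v\<close>.\<close>

lemma chain_trace:
  assumes A: "open_lists A" and \<eta>: "0 < \<eta>" and a: "map e a \<in> A"
    and v: "(map e a, v) \<in> {(u, v). u \<in> A \<and> v \<in> A \<and> near d \<eta> u v}\<^sup>*"
  shows "\<exists>s>0. \<forall>ns. near d s v (map e ns) \<longrightarrow>
    (a, ns) \<in> {(u, v). map e u \<in> A \<and> map e v \<in> A \<and> near di \<eta> u v}\<^sup>*"
  using v
proof (induction rule: rtrancl_induct)
  case base
  obtain s where s: "s > 0" "\<forall>y\<in>lists X. near d s (map e a) y \<longrightarrow> y \<in> A" using open_listsD[OF A a] by blast
  show ?case
  proof (intro exI[of _ "min s \<eta>"] conjI allI impI)
    fix ns assume n: "near d (min s \<eta>) (map e a) (map e ns)"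
    have "map e ns \<in> A" using s map_e_lists near_mono[OF n, of s] by simp
    then show "(a, ns) \<in> {(u, v). map e u \<in> A \<and> map e v \<in> A \<and> near di \<eta> u v}\<^sup>*"
      using a near_mono[OF n, of \<eta>] by (auto simp: near_map)
  qed (use s \<eta> in simp)
next
  case (step v w)
  then have vw: "v \<in> A" "w \<in> A" "near d \<eta> v w" by auto
  then have vwX: "v \<in> lists X" "w \<in> lists X" using A by (auto simp: open_lists_def)
  obtain s where s: "s > 0" "\<And>ns. near d s v (map e ns) \<Longrightarrow>
    (a, ns) \<in> {(u, v). map e u \<in> A \<and> map e v \<in> A \<and> near di \<eta> u v}\<^sup>*" using step by blast
  \<comment> \<open>The new link has size below \<open>h\<close>; the slack \<eta> -
    \<open>h\<close> is shared equally by its two ends.\<close>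
  obtain h where h: "of_rat h < \<eta>" "near d (of_rat h) v w" using near_margin[OF vw(3) \<eta>] by blast
  obtain m where m: "near d (min s ((\<eta> - of_rat h) / 2)) v (map e m)" "map e m \<in> A"
    using approx_open[OF A vw(1), of "min s ((\<eta> - of_rat h) / 2)"] s h by auto
  obtain t where t: "t > 0" "\<forall>y\<in>lists X. near d t w y \<longrightarrow> y \<in> A" using open_listsD[OF A vw(2)] by blast
  show ?case
  proof (intro exI[of _ "min t ((\<eta> - of_rat h) / 2)"] conjI allI impI)
    fix ns assume n: "near d (min t ((\<eta> - of_rat h) / 2)) w (map e ns)"
    have nA: "map e ns \<in> A" using t map_e_lists near_mono[OF n, of t] by simp
    have "near d ((\<eta> - of_rat h) / 2) v (map e m)" using m near_mono by (metis min.cobounded2)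
    then have "near d ((\<eta> - of_rat h) / 2 + of_rat h) (map e m) w"
      by (intro near_tri[OF map_e_lists vwX near_sym[OF vwX(1) map_e_lists] h(2)])
    moreover have "near d ((\<eta> - of_rat h) / 2) w (map e ns)" using n near_mono by (metis min.cobounded2)
    ultimately have "near d ((\<eta> - of_rat h) / 2 + of_rat h + (\<eta> - of_rat h) / 2) (map e m) (map e ns)"
      by (rule near_tri[OF map_e_lists vwX(2) map_e_lists])
    then have "near d \<eta> (map e m) (map e ns)" by (rule near_mono) simp
    then have "(m, ns) \<in> {(u, v). map e u \<in> A \<and> map e v \<in> A \<and> near di \<eta> u v}"
      using m nA by (simp add: near_map)
    moreover have "(a, m) \<in> {(u, v). map e u \<in> A \<and> map e v \<in> A \<and> near di \<eta> u v}\<^sup>*"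
      by (rule s(2), rule near_mono[OF m(1)]) simp
    ultimately show "(a, ns) \<in> {(u, v). map e u \<in> A \<and> map e v \<in> A \<and> near di \<eta> u v}\<^sup>*"
      by (rule rtrancl_into_rtrancl[rotated])
  qed (use t h in simp)
qed

text \<open>A canonical set is determined by the indices of the dense sequence that it contains.\<close>
lemma trace: "ns \<in> I C \<longleftrightarrow> map e ns \<in> J C"
proof (induction C arbitrary: ns)
  case (Basic \<beta>) then show ?case by (simp add: trace_cond)
next
  case (Meet C S) then show ?case by simp
next
  case (Shadow j \<eta> C S)
  have "(\<exists>r h. 2 * \<eta> < r \<and> h < \<eta> \<and> (\<forall>u\<in>I C. j \<le> length u \<and> near di (of_rat r) (take j ns) (take j u) \<longrightarrow>
           (\<exists>v\<in>I S. j \<le> length v \<and> near di (of_rat h) (take j u) (take j v)))) \<longleftrightarrow>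
        (\<exists>r h. 2 * \<eta> < r \<and> h < \<eta> \<and> (\<forall>u\<in>J C. j \<le> length u \<and> near d (of_rat r) (take j (map e ns)) (take j u) \<longrightarrow>
           (\<exists>v\<in>J S. j \<le> length v \<and> near d (of_rat h) (take j u) (take j v))))" (is "?l \<longleftrightarrow> ?r")
  proof
    assume ?l
    then obtain r h where *: "2 * \<eta> < r" "h < \<eta>" "\<And>u. u \<in> I C \<Longrightarrow> j \<le> length u \<Longrightarrow> near di (of_rat r) (take j ns) (take j u) \<Longrightarrow>
           (\<exists>v\<in>I S. j \<le> length v \<and> near di (of_rat h) (take j u) (take j v))" by blast
    obtain r2 h2 where r2: "2 * \<eta> < r2" "r2 < r" "h < h2" "h2 < \<eta>" using * dense by metis
    have "\<exists>v\<in>J S. j \<le> length v \<and> near d (of_rat h2) (take j u) (take j v)"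
      if u: "u \<in> J C" "j \<le> length u" "near d (of_rat r2) (take j (map e ns)) (take j u)" for u
    proof -
      define t :: real where "t = min (of_rat r - of_rat r2) (of_rat h2 - of_rat h)"
      have "t > 0" using r2 by (simp add: t_def of_rat_less)
      then obtain m where m: "near d t u (map e m)" "map e m \<in> J C" using approx_open[OF open_cyl_set u(1)] by blast
      have uX: "u \<in> lists X" using u cyl_set_lists by blast
      have nt: "near d t (take j u) (take j (map e m))" using near_take m by blast
      have "near d (of_rat r2 + t) (take j (map e ns)) (take j (map e m))"
        by (intro near_tri[OF _ _ _ u(3) nt] take_lists uX map_e_lists)
      then have "near d (of_rat r) (take j (map e ns)) (take j (map e m))" by (rule near_mono) (simp add: t_def)
      then have "near di (of_rat r) (take j ns) (take j m)" by (simp add: near_map take_map)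
      then obtain v where v: "v \<in> I S" "j \<le> length v" "near di (of_rat h) (take j m) (take j v)"
        using *(3)[of m] m u Shadow near_length[OF m(1)] by auto
      have "near d (of_rat h) (take j (map e m)) (take j (map e v))" using v by (simp add: near_map take_map)
      then have "near d (t + of_rat h) (take j u) (take j (map e v))"
        by (intro near_tri[OF _ _ _ nt] take_lists uX map_e_lists)
      then have "near d (of_rat h2) (take j u) (take j (map e v))" by (rule near_mono) (simp add: t_def)
      then show ?thesis using v Shadow by (intro bexI[of _ "map e v"]) auto
    qed
    then show ?r using r2 by blast
  next
    assume ?r
    then obtain r h where *: "2 * \<eta> < r" "h < \<eta>" "\<And>u. u \<in> J C \<Longrightarrow> j \<le> length u \<Longrightarrow> near d (of_rat r) (take j (map e ns)) (take j u) \<Longrightarrow>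
           (\<exists>v\<in>J S. j \<le> length v \<and> near d (of_rat h) (take j u) (take j v))" by blast
    obtain h2 where h2: "h < h2" "h2 < \<eta>" using * dense by metis
    have "\<exists>v\<in>I S. j \<le> length v \<and> near di (of_rat h2) (take j u) (take j v)"
      if u: "u \<in> I C" "j \<le> length u" "near di (of_rat r) (take j ns) (take j u)" for u
    proof -
      obtain v where v: "v \<in> J S" "j \<le> length v" "near d (of_rat h) (take j (map e u)) (take j v)"
        using *(3)[of "map e u"] u Shadow by (auto simp: near_map take_map)
      have "(of_rat h2 - of_rat h :: real) > 0" using h2 by (simp add: of_rat_less)
      then obtain m where m: "near d (of_rat h2 - of_rat h) v (map e m)" "map e m \<in> J S"
        using approx_open[OF open_cyl_set v(1)] by blast
      have "near d (of_rat h + (of_rat h2 - of_rat h)) (take j (map e u)) (take j (map e m))"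
        by (intro near_tri[OF _ _ _ v(3) near_take[OF m(1)]] cyl_set_lists[OF v(1)] take_lists map_e_lists)
      then have "near di (of_rat h2) (take j u) (take j m)" by (simp add: near_map take_map)
      then show ?thesis using m v Shadow near_length[OF m(1)] by auto
    qed
    then show ?l using * h2 by blast
  qed
  then show ?case using Shadow by simp
next
  case (Chain C \<eta> a)
  let ?RI = "{(u, v). u \<in> I C \<and> v \<in> I C \<and> near di (of_rat \<eta>) u v}"
  let ?RJ = "{(u, v). u \<in> J C \<and> v \<in> J C \<and> near d (of_rat \<eta>) u v}"
  have RI: "?RI = {(u, v). map e u \<in> J C \<and> map e v \<in> J C \<and> near di (of_rat \<eta>) u v}" using Chain by auto
  have "(a, w) \<in> ?RI\<^sup>* \<longleftrightarrow> (map e a, map e w) \<in> ?RJ\<^sup>*" if \<eta>: "0 < \<eta>" and a: "map e a \<in> J C" for w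
  proof
    assume "(a, w) \<in> ?RI\<^sup>*"
    then show "(map e a, map e w) \<in> ?RJ\<^sup>*"
    proof (induction rule: rtrancl_induct)
      case (step y z)
      then have "(map e y, map e z) \<in> ?RJ" using Chain by (simp add: near_map)
      then show ?case using step(3) by (rule rtrancl_into_rtrancl[rotated])
    qed simp
  next
    assume "(map e a, map e w) \<in> ?RJ\<^sup>*"
    then obtain s where "s > 0" "\<forall>ns. near d s (map e w) (map e ns) \<longrightarrow> (a, ns) \<in> ?RI\<^sup>*"
      using chain_trace[OF open_cyl_set _ a, of "of_rat \<eta>"] \<eta> unfolding RI by auto
    then show "(a, w) \<in> ?RI\<^sup>*" using near_refl[OF map_e_lists] by blast
  qed
  then show ?case using Chain e_mem by (auto simp: take_map)
next
  case (Pull i C)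
  have "(\<exists>u\<in>I C. u \<noteq> [] \<and> hd u = ns ! i) \<longleftrightarrow> (\<exists>u\<in>J C. u \<noteq> [] \<and> hd u = e (ns ! i))" (is "?l \<longleftrightarrow> ?r")
  proof
    assume ?l then show ?r using Pull by (metis hd_map map_is_Nil_conv)
  next
    assume ?r
    then obtain w where w: "e (ns!i) # w \<in> J C" by (metis list.collapse)
    obtain s where s: "s > 0" "\<And>y. y \<in> lists X \<Longrightarrow> near d s (e (ns!i) # w) y \<Longrightarrow> y \<in> J C"
      using open_listsD[OF open_cyl_set w] by blast
    have "w \<in> lists X" using cyl_set_lists[OF w] by simp
    then obtain m where "near d s w (map e m)" using approx_list s by blast
    then have "map e (ns!i # m) \<in> J C" using s(2)[OF map_e_lists[of "ns!i # m"]] s(1) e_mem d_refl by (simp add: near_def)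
    then show ?l using Pull by (intro bexI[of _ "ns!i # m"]) auto
  qed
  then show ?case using e_mem by auto
qed

text \<open>Both sets are open, so a tuple can be moved to indexed entries without leaving its set;
  the displacement is absorbed by the gap between \<open>h\<close> and \<eta>, or by the closure in
  \<open>InCl\<close>.\<close>

lemma link_trace: "link_rel UNIV di Pi' \<rho> (I C) (I S) \<longleftrightarrow> link_rel X d P \<rho> (J C) (J S)"
proof (cases \<rho>)
  case (Near "is" js \<eta>)
  show ?thesis
  proof
    assume "link_rel UNIV di Pi' \<rho> (I C) (I S)"
    then obtain h where h: "h < \<eta>" "\<And>u. u \<in> I C \<Longrightarrow> \<forall>i\<in>set is. i < length u \<Longrightarrow>
      \<exists>v\<in>I S. (\<forall>j\<in>set js. j < length v) \<and> near di (of_rat h) (map ((!) u) is) (map ((!) v) js)" using Near by auto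
    obtain h2 where h2: "h < h2" "h2 < \<eta>" using h dense by blast
    have "\<exists>v\<in>J S. (\<forall>j\<in>set js. j < length v) \<and> near d (of_rat h2) (map ((!) u) is) (map ((!) v) js)"
      if u: "u \<in> J C" "\<forall>i\<in>set is. i < length u" for u
    proof -
      have "(of_rat h2 - of_rat h :: real) > 0" using h2 by (simp add: of_rat_less)
      then obtain m where m: "near d (of_rat h2 - of_rat h) u (map e m)" "map e m \<in> J C"
        using approx_open[OF open_cyl_set u(1)] by blast
      have len: "\<forall>i\<in>set is. i < length m" using u near_length[OF m(1)] by auto
      then obtain v where v: "v \<in> I S" "\<forall>j\<in>set js. j < length v" "near di (of_rat h) (map ((!) m) is) (map ((!) v) js)"
        using h(2)[of m] m trace by auto
      have v2: "near d (of_rat h) (map ((!) (map e m)) is) (map ((!) (map e v)) js)"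
        using v(3) v(2) len by (simp add: near_map[symmetric] cong: map_cong)
      have "near d (of_rat h2 - of_rat h + of_rat h) (map ((!) u) is) (map ((!) (map e v)) js)"
        by (rule near_tri[OF _ _ _ near_nth_map[OF m(1) u(2)] v2])
          (use cyl_set_lists[OF u(1)] u(2) v(2) len e_mem in \<open>auto simp: in_lists_conv_set\<close>)
      then show ?thesis using v trace by (intro bexI[of _ "map e v"]) auto
    qed
    then show "link_rel X d P \<rho> (J C) (J S)" using h2 Near by auto
  next
    assume "link_rel X d P \<rho> (J C) (J S)"
    then obtain h where h: "h < \<eta>" "\<And>u. u \<in> J C \<Longrightarrow> \<forall>i\<in>set is. i < length u \<Longrightarrow>
      \<exists>v\<in>J S. (\<forall>j\<in>set js. j < length v) \<and> near d (of_rat h) (map ((!) u) is) (map ((!) v) js)" using Near by auto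
    obtain h2 where h2: "h < h2" "h2 < \<eta>" using h dense by blast
    have "\<exists>v\<in>I S. (\<forall>j\<in>set js. j < length v) \<and> near di (of_rat h2) (map ((!) u) is) (map ((!) v) js)"
      if u: "u \<in> I C" "\<forall>i\<in>set is. i < length u" for u
    proof -
      obtain v where v: "v \<in> J S" "\<forall>j\<in>set js. j < length v" "near d (of_rat h) (map ((!) (map e u)) is) (map ((!) v) js)"
        using h(2)[of "map e u"] u trace by auto
      have "(of_rat h2 - of_rat h :: real) > 0" using h2 by (simp add: of_rat_less)
      then obtain m where m: "near d (of_rat h2 - of_rat h) v (map e m)" "map e m \<in> J S"
        using approx_open[OF open_cyl_set v(1)] by blast
      have len: "\<forall>i\<in>set js. i < length m" using v near_length[OF m(1)] by auto
      have "near d (of_rat h + (of_rat h2 - of_rat h)) (map ((!) (map e u)) is) (map ((!) (map e m)) js)"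
        by (rule near_tri[OF _ _ _ v(3) near_nth_map[OF m(1) v(2)]])
          (use cyl_set_lists[OF v(1)] u(2) v(2) len e_mem in \<open>auto simp: in_lists_conv_set\<close>)
      then have "near di (of_rat h2) (map ((!) u) is) (map ((!) m) js)"
        using u(2) len by (simp add: near_map[symmetric] cong: map_cong)
      then show ?thesis using m len trace by auto
    qed
    then show "link_rel UNIV di Pi' \<rho> (I C) (I S)" using h2 Near by auto
  qed
next
  case (InCl \<beta>)
  show ?thesis
  proof
    assume l: "link_rel UNIV di Pi' \<rho> (I C) (I S)"
    have "\<exists>v\<in>cond_set X d P \<beta>. near d (of_rat s) u v" if u: "u \<in> J C" and s: "s > 0" for u and s :: rat
    proof -
      obtain m where m: "near d (of_rat (s/2)) u (map e m)" "map e m \<in> J C"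
        using approx_open[OF open_cyl_set u, of "of_rat (s/2)"] s by auto
      have "m \<in> I C" "0 < s/2" using m trace s by auto
      then obtain v where v: "v \<in> cond_set UNIV di Pi' \<beta>" "near di (of_rat (s/2)) m v" using l unfolding InCl link_rel.simps by blast
      then have "near d (of_rat (s/2) + of_rat (s/2)) u (map e v)"
        by (intro near_tri[OF cyl_set_lists[OF u] map_e_lists map_e_lists m(1)]) (simp add: near_map)
      then have "near d (of_rat s) u (map e v)" by (metis field_sum_of_halves of_rat_add)
      then show ?thesis using v trace_cond by blast
    qed
    then show "link_rel X d P \<rho> (J C) (J S)" using InCl by auto
  next
    assume l: "link_rel X d P \<rho> (J C) (J S)"
    have "\<exists>v\<in>cond_set UNIV di Pi' \<beta>. near di (of_rat s) u v" if u: "u \<in> I C" and s: "s > 0" for u and s :: rat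
    proof -
      have "map e u \<in> J C" "0 < s/2" using u trace s by auto
      then obtain v where v: "v \<in> cond_set X d P \<beta>" "near d (of_rat (s/2)) (map e u) v" using l unfolding InCl link_rel.simps by blast
      obtain m where m: "near d (of_rat (s/2)) v (map e m)" "map e m \<in> cond_set X d P \<beta>"
        using approx_open[OF open_cond_set v(1), of "of_rat (s/2)"] s by auto
      have "v \<in> lists X" using v open_cond_set by (auto simp: open_lists_def)
      then have "near d (of_rat (s/2) + of_rat (s/2)) (map e u) (map e m)"
        by (rule near_tri[OF map_e_lists _ map_e_lists v(2) m(1)])
      then have "near d (of_rat s) (map e u) (map e m)" by (metis field_sum_of_halves of_rat_add)
      then show ?thesis using m trace_cond by (auto simp: near_map)
    qed
    then show "link_rel UNIV di Pi' \<rho> (I C) (I S)" using InCl by auto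
  qed
qed

end

section \<open>Independence of the dense sequence\<close>

lemma (in pms) chain_cong:
  assumes "u \<in> A" "v \<in> A" "A \<subseteq> lists X" "near d s u v"
  shows "(u, w) \<in> {(u, v). u \<in> A \<and> v \<in> A \<and> near d s u v}\<^sup>* \<longleftrightarrow>
         (v, w) \<in> {(u, v). u \<in> A \<and> v \<in> A \<and> near d s u v}\<^sup>*" (is "_ \<in> ?R\<^sup>* \<longleftrightarrow> _")
proof -
  have "(u, v) \<in> ?R" "(v, u) \<in> ?R" using assms near_sym[OF subsetD[OF assms(3,1)] subsetD[OF assms(3,2)] assms(4)] by auto
  then show ?thesis by (meson converse_rtrancl_into_rtrancl)
qed

text \<open>Only base points of \<open>Chain\<close> depend on the sequence. By openness the second
  sequence has a tuple of the same set within \<eta> of the base point, and it names the same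
  component.\<close>

lemma cyl_set_match:
  assumes "dense_pms X d P e1" "dense_pms X d P e2"
  shows "\<exists>D. cyl_set X d P e1 C = cyl_set X d P e2 D"
proof -
  interpret a: dense_pms X d P e1 by fact
  interpret b: dense_pms X d P e2 by fact
  show ?thesis
  proof (induction C)
    case (Basic \<beta>) then show ?case by (intro exI[of _ "Basic \<beta>"]) simp
  next
    case (Meet C S)
    then obtain C' S' where "a.J C = b.J C'" "a.J S = b.J S'" by blast
    then show ?case by (intro exI[of _ "Meet C' S'"]) simp
  next
    case (Shadow j \<eta> C S)
    then obtain C' S' where "a.J C = b.J C'" "a.J S = b.J S'" by blast
    then show ?case by (intro exI[of _ "Shadow j \<eta> C' S'"]) simp
  next
    case (Pull i C)
    then obtain C' where "a.J C = b.J C'" by blast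
    then show ?case by (intro exI[of _ "Pull i C'"]) simp
  next
    case (Chain C \<eta> as)
    then obtain C' where C': "a.J C = b.J C'" by blast
    show ?case
    proof (cases "0 < \<eta> \<and> map e1 as \<in> a.J C")
      case True
      then have "(of_rat \<eta> :: real) > 0" by simp
      then obtain bs where bs: "near d (of_rat \<eta>) (map e1 as) (map e2 bs)" "map e2 bs \<in> a.J C"
        using b.approx_open[OF a.open_cyl_set] True by blast
      have len: "length as = length bs" using near_length[OF bs(1)] by simp
      have "a.J C \<subseteq> lists X" using a.cyl_set_lists by blast
      note cc = a.chain_cong[OF conjunct2[OF True] bs(2) this bs(1)]
      show ?thesis using True bs cc C' by (intro exI[of _ "Chain C' \<eta> bs"]) (simp add: len)
    next
      \<comment> \<open>The component is empty but still needs an expression; a negative bound on a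
        distance holds nowhere.\<close>
      case False
      have "0 \<le> d (x ! 0) (x ! 0)" if "x \<in> lists X" "x \<noteq> []" for x
        using that a.d_nonneg[of "x!0" "x!0"] by (auto simp: in_lists_conv_set)
      then show ?thesis using False by (intro exI[of _ "Basic (DistLt 0 0 (-1))"]) fastforce
    qed
  qed
qed

section \<open>The invariant structure of a code\<close>

text \<open>Both fibres over a value are countably infinite, so an index can be sent to the one of
  equal rank in the other fibre.\<close>

lemma bij_of_infinite_fibres:
  fixes V W :: "nat \<Rightarrow> 'v"
  assumes "range V = range W" "\<And>i. infinite (V -` {V i})" "\<And>i. infinite (W -` {W i})"
  shows "\<exists>\<pi>. bij \<pi> \<and> (\<forall>i. W (\<pi> i) = V i)"
proof -
  define g where "g A B i = from_nat_into (B -` {A i :: 'v}) (to_nat_on (A -` {A i}) i)" for A B :: "nat \<Rightarrow> 'v" and i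
  have g1: "B (g A B i) = A i" if "range A = range B" for A B i
  proof -
    have "B -` {A i} \<noteq> {}" using that by (metis rangeI image_iff vimage_singleton_eq empty_iff)
    then show ?thesis using from_nat_into[of "B -` {A i}"] by (auto simp: g_def)
  qed
  have g2: "g B A (g A B i) = i"
    if r: "range A = range B" and inf: "\<And>i. infinite (A -` {A i})" "\<And>i. infinite (B -` {B i})" for A B i
  proof -
    have "infinite (B -` {A i})" using inf(2)[of "g A B i"] g1[OF r] by simp
    then have "to_nat_on (B -` {A i}) (g A B i) = to_nat_on (A -` {A i}) i"
      by (simp add: g_def to_nat_on_from_nat_into_infinite)
    then show ?thesis unfolding g_def[of B A] g1[OF r] by (simp add: from_nat_into_to_nat_on)
  qed
  have "bij (g V W)"
    by (rule o_bij[of "g W V"]) (use assms g2 in \<open>auto simp: fun_eq_iff\<close>)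
  then show ?thesis using g1 assms by blast
qed

text \<open>Each set is listed infinitely often, so that codes of isomorphic structures list it equally often.\<close>
definition expr :: "nat \<Rightarrow> cyl" where "expr i = from_nat (fst (prod_decode i))"

lemma expr_fibre: "infinite (expr -` {expr i})"
proof -
  have "range (\<lambda>n. prod_encode (fst (prod_decode i), n)) \<subseteq> expr -` {expr i}"
    by (auto simp: expr_def)
  moreover have "infinite (range (\<lambda>n. prod_encode (fst (prod_decode i), n)))"
    by (rule range_inj_infinite) (auto simp: inj_def)
  ultimately show ?thesis using infinite_super by blast
qed

lemma expr_surj: "\<exists>i. expr i = C"
  by (rule exI[of _ "prod_encode (to_nat C, 0)"]) (simp add: expr_def)

abbreviation cd :: "code \<Rightarrow> nat \<Rightarrow> nat \<Rightarrow> real" where "cd c \<equiv> \<lambda>m n. c (Inl (m, n))"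
abbreviation cP :: "code \<Rightarrow> nat \<Rightarrow> nat list \<Rightarrow> real" where "cP c \<equiv> \<lambda>p is. c (Inr (p, is))"
abbreviation cset :: "code \<Rightarrow> cyl \<Rightarrow> nat list set" where "cset c \<equiv> cyl_set UNIV (cd c) (cP c) (\<lambda>n. n)"

text \<open>Every link is a binary relation symbol, numbered by \<open>r\<close>; the elements are
  the positions in the list of expressions.\<close>

definition invariant :: "code \<Rightarrow> nat \<times> nat list \<Rightarrow> bool" where
  "invariant c = (\<lambda>(r, xs). link_rel UNIV (cd c) (cP c) (from_nat r) (cset c (expr (xs!0))) (cset c (expr (xs!1))))"

section \<open>Borel dependence of the invariant on the code\<close>

lemma code_coord [measurable]: "(\<lambda>c::code. c k) \<in> borel_measurable borel"
  by (intro borel_measurable_continuous_onI continuous_on_product_coordinates)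

lemma near_meas [measurable]: "Measurable.pred borel (\<lambda>c::code. near (cd c) s x y)"
  unfolding near_iff by measurable

lemma cond_meas [measurable]: "Measurable.pred borel (\<lambda>c::code. x \<in> cond_set UNIV (cd c) (cP c) \<beta>)"
  by (cases \<beta>) (simp_all add: tb_ball_def)

text \<open>Over indices all quantifiers range over countable types, and a chain is an element of
  some finite power of the link relation. Countable Boolean operations on coordinate conditions
  therefore suffice.\<close>

lemma cset_meas: "Measurable.pred borel (\<lambda>c::code. x \<in> cset c C)"
proof (induction C arbitrary: x)
  case (Chain C \<eta> a)
  note [measurable] = Chain
  let ?R = "\<lambda>c. {(u, v). u \<in> cset c C \<and> v \<in> cset c C \<and> near (cd c) (of_rat \<eta>) u v}"
  have [measurable]: "Measurable.pred borel (\<lambda>c. (u, v) \<in> ?R c ^^ n)" for u v n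
  proof (induction n arbitrary: v)
    case (Suc n)
    note [measurable] = Suc
    have "(u, v) \<in> ?R c ^^ Suc n \<longleftrightarrow>
       (\<exists>w. (u, w) \<in> ?R c ^^ n \<and> w \<in> cset c C \<and> v \<in> cset c C \<and> near (cd c) (of_rat \<eta>) w v)" for c
      by auto
    then show ?case by simp
  qed simp
  have "Measurable.pred borel (\<lambda>c. (u, v) \<in> (?R c)\<^sup>*)" for u v
    unfolding rtrancl_power by measurable
  then show ?case by simp
next
  case (Shadow j \<eta> C S)
  note [measurable] = Shadow
  show ?case by (simp add: Bex_def Ball_def)
next
  case (Meet C S)
  note [measurable] = Meet
  show ?case by simp
next
  case (Pull i C)
  note [measurable] = Pull
  show ?case by (simp add: Bex_def)
qed simp

lemma invariant_meas: "invariant \<in> measurable borel (PiM UNIV (\<lambda>_. count_space UNIV))"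
proof (rule measurable_PiM_single')
  fix k :: "nat \<times> nat list"
  note [measurable] = cset_meas
  show "(\<lambda>c. invariant c k) \<in> measurable borel (count_space UNIV)"
  proof (cases k)
    case (Pair r xs)
    show ?thesis
      by (cases "from_nat r :: link") (simp_all add: Pair invariant_def Bex_def Ball_def)
  qed
qed simp

section \<open>Isomorphic structures have isomorphic invariants\<close>

text \<open>The default 0 agrees with the convention for codes and makes \<open>P_cont\<close> hold
  for all symbols and all tuples.\<close>

definition total_pred :: "signature \<Rightarrow> 'u mstruc \<Rightarrow> nat \<Rightarrow> 'u list \<Rightarrow> real" where
  "total_pred L M p as = (if p \<in> Preds L \<and> length as = arity L p then mpred M p as else 0)"

lemma pms_structure:
  assumes "signature_ok L" "metric_structure L M"
  shows "pms (carrier M) (mdst M) (total_pred L M)"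
proof -
  interpret Metric_space "carrier M" "mdst M" using assms by (simp add: metric_structure_def)
  show ?thesis
  proof
    fix xs \<epsilon> p assume xs: "xs \<in> lists (carrier M)" and \<epsilon>: "(0::real) < \<epsilon>"
    show "\<exists>s>0. \<forall>ys\<in>lists (carrier M). near (mdst M) s xs ys \<longrightarrow> \<bar>total_pred L M p xs - total_pred L M p ys\<bar> < \<epsilon>"
    proof (cases "p \<in> Preds L \<and> length xs = arity L p")
      case True
      show ?thesis
      proof (intro exI[of _ "modulus L p (\<epsilon>/2)"] conjI ballI impI)
        show "modulus L p (\<epsilon>/2) > 0" using assms True \<epsilon> by (simp add: signature_ok_def)
        fix ys assume ys: "ys \<in> lists (carrier M)" "near (mdst M) (modulus L p (\<epsilon>/2)) xs ys"
        then have "\<bar>mpred M p xs - mpred M p ys\<bar> \<le> \<epsilon>/2"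
          using assms(2) True xs \<epsilon> unfolding metric_structure_def near_iff
          by (metis (no_types, lifting) half_gt_zero_iff in_lists_conv_set subsetI)
        then show "\<bar>total_pred L M p xs - total_pred L M p ys\<bar> < \<epsilon>"
          using \<epsilon> True near_length[OF ys(2)] by (simp add: total_pred_def)
      qed
    next
      case False
      then show ?thesis using \<epsilon> by (intro exI[of _ 1]) (auto simp: total_pred_def dest: near_length)
    qed
  qed (auto simp: commute triangle)
qed

lemma codes_dense:
  assumes "signature_ok L" "codes L c M e"
  shows "dense_pms (carrier M) (mdst M) (total_pred L M) e"
proof -
  have M: "metric_structure L M" using assms by (simp add: codes_def polish_structure_def)
  interpret Metric_space "carrier M" "mdst M" using M by (simp add: metric_structure_def)
  interpret pms "carrier M" "mdst M" "total_pred L M" using pms_structure assms M by blast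
  show ?thesis
  proof
    show "e n \<in> carrier M" for n using assms by (auto simp: codes_def)
    fix x s assume "x \<in> carrier M" "(0::real) < s"
    moreover have "mtopology closure_of (e ` {0..}) = carrier M"
      using assms unfolding codes_def mtop_def by blast
    ultimately show "\<exists>n. mdst M x (e n) < s" unfolding metric_closure_of by auto
  qed
qed

lemma codes_eq:
  assumes "codes L c M e"
  shows "cd c = (\<lambda>m n. mdst M (e m) (e n))" "cP c = (\<lambda>p is. total_pred L M p (map e is))"
  using assms by (auto simp: codes_def total_pred_def fun_eq_iff)

text \<open>Carrying \<open>e\<close> along the isomorphism turns \<open>c\<close> into the data of
  a second dense sequence \<open>g\<close> in \<open>N\<close>. The two codes then list the same
  family of subsets of \<open>N\<close>, each member infinitely often.\<close>

lemma invariant_iso: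
  assumes L: "signature_ok L" and M: "codes L c M e" and N: "codes L c' N e'" and iso: "iso_struc L M N"
  shows "ctbl_iso (\<lambda>_. 2) (invariant c) (invariant c')"
proof -
  obtain f where f: "bij_betw f (carrier M) (carrier N)"
    "\<And>x y. x \<in> carrier M \<Longrightarrow> y \<in> carrier M \<Longrightarrow> mdst N (f x) (f y) = mdst M x y"
    "\<And>p as. p \<in> Preds L \<Longrightarrow> set as \<subseteq> carrier M \<Longrightarrow> length as = arity L p \<Longrightarrow> mpred N p (map f as) = mpred M p as"
    using iso unfolding iso_struc_def by blast
  interpret a: dense_pms "carrier M" "mdst M" "total_pred L M" e using codes_dense L M .
  interpret b: dense_pms "carrier N" "mdst N" "total_pred L N" e' using codes_dense L N .
  define g where "g = (\<lambda>n. f (e n))"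
  interpret g: dense_pms "carrier N" "mdst N" "total_pred L N" g
  proof
    show "g n \<in> carrier N" for n using f(1) a.e_mem by (auto simp: g_def bij_betw_def)
    fix y s assume y: "y \<in> carrier N" "(0::real) < s"
    then obtain x where x: "x \<in> carrier M" "y = f x" using f(1) by (auto simp: bij_betw_def)
    then show "\<exists>n. mdst N y (g n) < s" using a.e_dense[of x s] y f(2) a.e_mem by (auto simp: g_def)
  qed
  have eq: "cd c = g.di" "cP c = g.Pi'"
  proof -
    show "cd c = g.di" using codes_eq(1)[OF M] f(2) a.e_mem by (simp add: g_def)
    have "set (map e is) \<subseteq> carrier M" for "is" using a.e_mem by auto
    then have "total_pred L M p (map e is) = total_pred L N p (map g is)" for p "is"
      using f(3)[of p "map e is"] by (simp add: total_pred_def g_def o_def)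
    then show "cP c = g.Pi'" using codes_eq(2)[OF M] by simp
  qed
  have eq': "cd c' = b.di" "cP c' = b.Pi'" using codes_eq[OF N] by auto
  define V W where "V = (\<lambda>i. g.J (expr i))" and "W = (\<lambda>i. b.J (expr i))"
  have "range V = range W"
  proof -
    have "\<exists>j. V i = W j" for i
      using cyl_set_match[OF g.dense_pms_axioms b.dense_pms_axioms, of "expr i"] expr_surj by (metis V_def W_def)
    moreover have "\<exists>j. W i = V j" for i
      using cyl_set_match[OF b.dense_pms_axioms g.dense_pms_axioms, of "expr i"] expr_surj by (metis V_def W_def)
    ultimately have "range V \<subseteq> range W" "range W \<subseteq> range V" by (metis image_subsetI rangeI)+
    then show ?thesis by (rule subset_antisym)
  qed
  moreover have "infinite (V -` {V i})" for i
  proof (rule infinite_super[OF _ expr_fibre[of i]])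
    show "expr -` {expr i} \<subseteq> V -` {V i}" by (simp add: V_def vimage_def Collect_mono)
  qed
  moreover have "infinite (W -` {W i})" for i
  proof (rule infinite_super[OF _ expr_fibre[of i]])
    show "expr -` {expr i} \<subseteq> W -` {W i}" by (simp add: W_def vimage_def Collect_mono)
  qed
  ultimately obtain \<pi> where \<pi>: "bij \<pi>" "\<And>i. W (\<pi> i) = V i" using bij_of_infinite_fibres[of V W] by blast
  have "invariant c (r, xs) = invariant c' (r, map \<pi> xs)" if xs: "length xs = 2" for r xs
  proof -
    have "invariant c (r, xs) = link_rel (carrier N) (mdst N) (total_pred L N) (from_nat r) (V (xs!0)) (V (xs!1))"
      unfolding invariant_def eq V_def by (simp add: g.link_trace)
    also have "\<dots> = link_rel (carrier N) (mdst N) (total_pred L N) (from_nat r) (W (map \<pi> xs!0)) (W (map \<pi> xs!1))"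
      using xs \<pi> by simp
    also have "\<dots> = invariant c' (r, map \<pi> xs)"
      unfolding invariant_def eq' W_def by (simp add: b.link_trace)
    finally show ?thesis .
  qed
  then show ?thesis unfolding ctbl_iso_def using \<pi> by blast
qed

section \<open>Canonical sets that settle around a sequence\<close>

context pms begin

lemma tb_lists:
  assumes "x \<in> lists X" "\<forall>a\<in>set x. tb_ball X d a r" "0 < s"
  shows "\<exists>F. finite F \<and> F \<subseteq> lists X \<and> (\<forall>y\<in>lists X. near d r x y \<longrightarrow> (\<exists>f\<in>F. near d (of_rat s) y f))"
  using assms
proof (induction x)
  case Nil
  then show ?case by (intro exI[of _ "{[]}"]) (auto simp: near_def)
next
  case (Cons a x)
  then obtain F where F: "finite F" "F \<subseteq> lists X" "\<And>y. y \<in> lists X \<Longrightarrow> near d r x y \<Longrightarrow> \<exists>f\<in>F. near d (of_rat s) y f" by auto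
  obtain G where G: "set G \<subseteq> X" "\<And>y. y \<in> X \<Longrightarrow> d y a < r \<Longrightarrow> \<exists>f\<in>set G. d y f < of_rat s"
    using Cons.prems unfolding tb_ball_def by (metis list.set_intros(1))
  show ?case
  proof (intro exI[of _ "(\<lambda>(g, f). g # f) ` (set G \<times> F)"] conjI ballI impI)
    show "(\<lambda>(g, f). g # f) ` (set G \<times> F) \<subseteq> lists X" using subsetD[OF F(2)] subsetD[OF G(1)] by (auto simp: in_lists_conv_set)
    fix y assume y: "y \<in> lists X" "near d r (a # x) y"
    then obtain b z where b: "y = b # z" "d a b < r" "near d r x z" "b \<in> X" "z \<in> lists X"
      by (cases y) (auto simp: near_def)
    moreover have "d b a < r" using b(2,4) Cons.hyps d_sym[of a b] by simp
    ultimately obtain g f where "g \<in> set G" "d b g < of_rat s" "f \<in> F" "near d (of_rat s) z f" using F G by blast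
    then show "\<exists>f\<in>(\<lambda>(g, f). g # f) ` (set G \<times> F). near d (of_rat s) y f" using b by (force simp: near_def)
  qed (use F in auto)
qed

definition seg :: "(nat \<Rightarrow> 'x) \<Rightarrow> (nat \<Rightarrow> nat) \<Rightarrow> nat \<Rightarrow> 'x list" where
  "seg e p l = map e (map p [0..<l])"

text \<open>These sets play the part of the type of the sequence; \<open>hits_Meet\<close> shows
  that they are closed under intersection.\<close>

definition hits :: "(nat \<Rightarrow> 'x) \<Rightarrow> (nat \<Rightarrow> nat) \<Rightarrow> cyl \<Rightarrow> bool" where
  "hits e p C \<longleftrightarrow> (\<exists>l. seg e p l \<in> cyl_set X d P e C)"

lemma length_seg [simp]: "length (seg e p l) = l" by (simp add: seg_def)

lemma seg_nth [simp]: "i < l \<Longrightarrow> seg e p l ! i = e (p i)" by (simp add: seg_def)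

lemma take_seg: "j \<le> l \<Longrightarrow> take j (seg e p l) = seg e p j"
  by (simp add: list_eq_iff_nth_eq)

lemma seg_lists: "range e \<subseteq> X \<Longrightarrow> seg e p l \<in> lists X"
  unfolding seg_def by (auto intro: subsetD[OF _ rangeI])

lemma seg_mono:
  assumes "range e \<subseteq> X" "seg e p l \<in> cyl_set X d P e C" "l \<le> k"
  shows "seg e p k \<in> cyl_set X d P e C"
proof -
  have "seg e p k = seg e p l @ map e (map p [l..<k])"
    using assms(3) upt_add_eq_append[of 0 l "k - l"] by (simp add: seg_def)
  then show ?thesis using cyl_set_append[OF assms(2), of "map e (map p [l..<k])"] assms(1)
    by (simp add: image_subset_iff in_lists_conv_set)
qed

lemma hits_eventually:
  assumes "range e \<subseteq> X" "hits e p C"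
  shows "\<exists>l\<ge>j. seg e p l \<in> cyl_set X d P e C"
  using assms seg_mono unfolding hits_def by (metis max.cobounded1 max.cobounded2)

lemma hits_Meet:
  assumes "range e \<subseteq> X" "hits e p C" "hits e p S"
  shows "hits e p (Meet C S)"
proof -
  obtain l where l: "seg e p l \<in> cyl_set X d P e C" using assms unfolding hits_def by blast
  obtain k where k: "k \<ge> l" "seg e p k \<in> cyl_set X d P e S" using hits_eventually assms by blast
  then show ?thesis using seg_mono[OF assms(1) l k(1)] unfolding hits_def by auto
qed

text \<open>Otherwise shrinking the set again and again yields an infinite separated sequence in a totally bounded ball.\<close>
lemma settle_locally:
  assumes e: "range e \<subseteq> X" and \<eta>: "0 < \<eta>"
    and tb: "\<forall>i<j. tb_ball X d (e (p i)) (of_rat (3 * \<eta>))"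
  shows "\<exists>C. hits e p C \<and> (\<forall>S. hits e p S \<longrightarrow> (\<forall>u\<in>cyl_set X d P e C. j \<le> length u \<and> near d (of_rat (3 * \<eta>)) (seg e p j) (take j u) \<longrightarrow>
     (\<exists>v\<in>cyl_set X d P e S. j \<le> length v \<and> near d (of_rat (\<eta> / 2)) (take j u) (take j v))))"
proof (rule ccontr)
  let ?J = "cyl_set X d P e"
  assume "\<not> ?thesis"
  then have "\<forall>C. \<exists>S u. hits e p C \<longrightarrow> hits e p S \<and> u \<in> ?J C \<and> j \<le> length u \<and> near d (of_rat (3 * \<eta>)) (seg e p j) (take j u)
     \<and> (\<forall>v\<in>?J S. j \<le> length v \<longrightarrow> \<not> near d (of_rat (\<eta> / 2)) (take j u) (take j v))" by blast
  then obtain S u where Su: "\<And>C. hits e p C \<Longrightarrow> hits e p (S C) \<and> u C \<in> ?J C \<and> j \<le> length (u C) \<and> near d (of_rat (3 * \<eta>)) (seg e p j) (take j (u C))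
     \<and> (\<forall>v\<in>?J (S C). j \<le> length v \<longrightarrow> \<not> near d (of_rat (\<eta> / 2)) (take j (u C)) (take j v))" by metis
  \<comment> \<open>Every nonempty tuple satisfies the starting condition. All later
    \<open>u (K m)\<close> lie in \<open>S (K n)\<close>, which has no member close to
    \<open>u (K n)\<close>.\<close>
  define K where "K = rec_nat (Basic (DistLt 0 0 1)) (\<lambda>_ C. Meet (S C) C)"
  have K0: "K 0 = Basic (DistLt 0 0 1)" and KS: "K (Suc n) = Meet (S (K n)) (K n)" for n by (auto simp: K_def)
  have "seg e p 1 \<in> ?J (K 0)" using d_refl[OF subsetD[OF e rangeI, of "p 0"]] seg_lists[OF e, of p 1] by (auto simp: K0 seg_def)
  then have hK: "hits e p (K n)" for n
    by (induction n) (use Su e in \<open>auto simp: KS hits_def[of e p "K 0"] intro: hits_Meet\<close>)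
  have "?J (K m) \<subseteq> ?J (S (K n))" if "n < m" for n m
    using that by (induction m) (auto simp: KS less_Suc_eq)
  then have sep: "\<not> near d (of_rat (\<eta> / 2)) (take j (u (K n))) (take j (u (K m)))" if "n < m" for n m
    using Su[OF hK[of n]] Su[OF hK[of m]] that by blast
  have uX: "take j (u (K n)) \<in> lists X" for n using Su[OF hK[of n]] cyl_set_lists take_lists by blast
  \<comment> \<open>By the pigeonhole principle a net of mesh \<eta>/4 brings two of the tuples
    within \<eta>/2 of each other.\<close>
  have "\<eta> / 4 > 0" using \<eta> by simp
  moreover have "\<forall>a\<in>set (seg e p j). tb_ball X d a (of_rat (3 * \<eta>))" using tb by (auto simp: seg_def)
  ultimately obtain F where F: "finite F" "F \<subseteq> lists X" "\<And>y. y \<in> lists X \<Longrightarrow> near d (of_rat (3 * \<eta>)) (seg e p j) y \<Longrightarrow> \<exists>f\<in>F. near d (of_rat (\<eta> / 4)) y f"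
    using tb_lists[OF seg_lists[OF e]] by meson
  then have "\<forall>n. \<exists>f\<in>F. near d (of_rat (\<eta> / 4)) (take j (u (K n))) f" using uX Su[OF hK] by blast
  then obtain f where f: "\<And>n. f n \<in> F" "\<And>n. near d (of_rat (\<eta> / 4)) (take j (u (K n))) (f n)" by metis
  have "\<not> inj f" using F(1) f(1) by (metis finite_subset image_subsetI infinite_UNIV_nat finite_imageD)
  then obtain n m where "n < m" "f n = f m" unfolding inj_def by (metis linorder_neqE_nat)
  moreover have "near d (of_rat (\<eta> / 4)) (f m) (take j (u (K m)))" using near_sym uX f F(2) by blast
  ultimately have "near d (of_rat (\<eta> / 4) + of_rat (\<eta> / 4)) (take j (u (K n))) (take j (u (K m)))"
    using near_tri[OF uX _ uX f(2)] f(1) F(2) by (metis subsetD)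
  then have "near d (of_rat (\<eta> / 2)) (take j (u (K n))) (take j (u (K m)))"
    by (rule near_mono) (simp add: of_rat_divide)
  then show False using sep \<open>n < m\<close> by blast
qed

text \<open>
  Iterating \<open>Shadow\<close> \<open>m\<close> times turns the local statement into one along chains of length \<open>m\<close>: each link
  of the chain uses up one application.
\<close>
lemma settle:
  assumes e: "range e \<subseteq> X" and \<eta>: "0 < \<eta>"
    and tb: "\<forall>i<j. tb_ball X d (e (p i)) (of_rat (3 * \<eta>))"
  shows "\<exists>C. hits e p C \<and> (\<forall>S. hits e p S \<longrightarrow>
     link_rel X d P (Near [0..<j] [0..<j] (2 * \<eta>)) (cyl_set X d P e C) (cyl_set X d P e S))"
proof -
  let ?J = "cyl_set X d P e"
  obtain C0 where C0: "hits e p C0" "\<And>S u. hits e p S \<Longrightarrow> u \<in> ?J C0 \<Longrightarrow> j \<le> length u \<Longrightarrow> near d (of_rat (3 * \<eta>)) (seg e p j) (take j u) \<Longrightarrow>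
     (\<exists>v\<in>?J S. j \<le> length v \<and> near d (of_rat (\<eta> / 2)) (take j u) (take j v))"
    using settle_locally[OF assms] by blast
  obtain k where k: "k \<ge> j" "seg e p k \<in> ?J C0" using hits_eventually[OF e C0(1)] by blast
  \<comment> \<open>The base segment may have to be longer than \<open>j\<close> to lie in
    \<open>C0\<close>.\<close>
  define C where "C = Chain C0 \<eta> (map p [0..<k])"
  let ?R = "{(u, v). u \<in> ?J C0 \<and> v \<in> ?J C0 \<and> near d (of_rat \<eta>) u v}"
  have "seg e p k \<in> ?J C" using k \<eta> cyl_set_lists[OF k(2)] by (auto simp: C_def seg_def)
  then have hC: "hits e p C" by (auto simp: hits_def)
  have shadow: "hits e p (Shadow j \<eta> C0 S)" if S: "hits e p S" for S
  proof -
    obtain l where l: "l \<ge> j" "seg e p l \<in> ?J S" using hits_eventually[OF e S] by blast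
    \<comment> \<open>The local statement has radius 3\<eta> and error \<eta>/2, strictly better
      than \<open>Shadow\<close> demands.\<close>
    have "2 * \<eta> < 3 * \<eta>" "\<eta> / 2 < \<eta>" using \<eta> by auto
    then have "\<exists>r h. 2 * \<eta> < r \<and> h < \<eta> \<and> (\<forall>u\<in>?J C0. j \<le> length u \<and> near d (of_rat r) (seg e p j) (take j u) \<longrightarrow>
        (\<exists>v\<in>?J S. j \<le> length v \<and> near d (of_rat h) (take j u) (take j v)))" using C0(2)[OF S] by blast
    then have "seg e p l \<in> ?J (Shadow j \<eta> C0 S)" using l by (simp add: take_seg)
    then show ?thesis by (auto simp: hits_def)
  qed
  \<comment> \<open>The quantifier over \<open>S\<close> belongs inside the induction: the step for
    \<open>S\<close> uses the hypothesis for \<open>Shadow j \<eta> C0 S\<close>.\<close>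
  have main: "\<forall>S. hits e p S \<longrightarrow> (\<exists>v\<in>?J S. j \<le> length v \<and> near d (of_rat \<eta>) (take j y) (take j v))"
    if "(seg e p k, y) \<in> ?R\<^sup>*" for y
    using that
  proof (induction rule: rtrancl_induct)
    case base
    show ?case
    proof (intro allI impI)
      fix S assume "hits e p S"
      then obtain l where l: "l \<ge> j" "seg e p l \<in> ?J S" using hits_eventually[OF e] by blast
      then show "\<exists>v\<in>?J S. j \<le> length v \<and> near d (of_rat \<eta>) (take j (seg e p k)) (take j v)"
        using k \<eta> near_refl[OF seg_lists[OF e]] by (intro bexI[of _ "seg e p l"]) (auto simp: take_seg)
    qed
  next
    case (step y z)
    show ?case
    proof (intro allI impI)
      fix S assume "hits e p S"
      then have "hits e p (Shadow j \<eta> C0 S)" by (rule shadow)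
      then obtain x where x: "x \<in> ?J (Shadow j \<eta> C0 S)" "j \<le> length x" "near d (of_rat \<eta>) (take j y) (take j x)"
        using step.IH by blast
      then obtain r h where rh: "2 * \<eta> < r" "h < \<eta>" "\<And>u. u \<in> ?J C0 \<Longrightarrow> j \<le> length u \<Longrightarrow> near d (of_rat r) (take j x) (take j u) \<Longrightarrow>
         \<exists>v\<in>?J S. j \<le> length v \<and> near d (of_rat h) (take j u) (take j v)" by auto
      have yz: "y \<in> ?J C0" "z \<in> ?J C0" "near d (of_rat \<eta>) y z" using step by auto
      have X: "take j x \<in> lists X" "take j y \<in> lists X" "take j z \<in> lists X"
        using x(1) yz cyl_set_lists take_lists by blast+
      have lz: "j \<le> length z" using near_rtrancl_length[OF step(1)] near_length[OF yz(3)] k by simp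
      have "near d (of_rat \<eta> + of_rat \<eta>) (take j x) (take j z)"
        by (rule near_tri[OF X(1,2,3) near_sym[OF X(2,1) x(3)] near_take[OF yz(3)]])
      then have "near d (of_rat r) (take j x) (take j z)"
        by (rule near_mono) (use rh(1) in \<open>metis less_eq_real_def mult_2 of_rat_add of_rat_less\<close>)
      then obtain v where "v \<in> ?J S" "j \<le> length v" "near d (of_rat h) (take j z) (take j v)" using rh(3) yz lz by blast
      then show "\<exists>v\<in>?J S. j \<le> length v \<and> near d (of_rat \<eta>) (take j z) (take j v)"
        using near_mono rh(2) by (metis less_eq_real_def of_rat_less)
    qed
  qed
  have "link_rel X d P (Near [0..<j] [0..<j] (2 * \<eta>)) (?J C) (?J S)" if S: "hits e p S" for S
    unfolding link_rel.simps
  proof (intro exI[of _ \<eta>] conjI ballI impI)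
    fix u assume u: "u \<in> ?J C" "\<forall>i\<in>set [0..<j]. i < length u"
    then have *: "k \<le> length u" "(seg e p k, take k u) \<in> ?R\<^sup>*" by (auto simp: C_def seg_def)
    then obtain v where v: "v \<in> ?J S" "j \<le> length v" "near d (of_rat \<eta>) (take j u) (take j v)"
      using main[OF *(2)] S k(1) by (auto simp: min_def)
    then show "\<exists>v\<in>?J S. (\<forall>j\<in>set [0..<j]. j < length v) \<and> near d (of_rat \<eta>) (map ((!) u) [0..<j]) (map ((!) v) [0..<j])"
      using * k by (intro bexI[of _ v]) (auto simp: take_eq_map_nth)
  qed (use \<eta> in simp)
  then show ?thesis using hC by blast
qed

end

section \<open>Metric structures\<close>

text \<open>Choose \<open>p (f n)\<close> converging to \<open>x\<close>. By the equality of
  distances \<open>b (f n)\<close> is a Cauchy sequence, and its limit is the required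
  point.\<close>

lemma isometric_extension:
  assumes A: "Metric_space A dA" and B: "Metric_space B dB" "Metric_space.mcomplete B dB"
    and p: "\<And>i. p i \<in> A" "\<And>x s. x \<in> A \<Longrightarrow> 0 < s \<Longrightarrow> \<exists>i. dA x (p i) < s"
    and b: "\<And>i. b i \<in> B" and eq: "\<And>i j. dB (b i) (b j) = dA (p i) (p j)" and x: "x \<in> A"
  shows "\<exists>y\<in>B. \<forall>k::nat. dB y (b k) = dA x (p k)"
proof -
  interpret A: Metric_space A dA by fact
  interpret B: Metric_space B dB by fact
  have "\<forall>n. \<exists>i. dA x (p i) < 1 / real (Suc n)" using p(2) x by simp
  then obtain f where f: "\<And>n. dA x (p (f n)) < 1 / real (Suc n)" by metis
  have tri: "dA (p (f m)) (p (f n)) \<le> dA x (p (f m)) + dA x (p (f n))" for m n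
    using A.triangle[of "p (f m)" x "p (f n)"] A.commute[of x] p x by auto
  have inv: "\<exists>N. \<forall>n\<ge>N. 1 / real (Suc n) < \<epsilon>" if "\<epsilon> > 0" for \<epsilon> :: real
  proof -
    obtain N where N: "inverse (real (Suc N)) < \<epsilon>" using reals_Archimedean \<open>\<epsilon> > 0\<close> by blast
    have "1 / real (Suc n) < \<epsilon>" if "N \<le> n" for n
      using that by (intro le_less_trans[OF _ N]) (simp add: inverse_eq_divide frac_le)
    then show ?thesis by blast
  qed
  have "B.MCauchy (\<lambda>n. b (f n))" unfolding B.MCauchy_def
  proof (intro conjI allI impI)
    fix \<epsilon> :: real assume "\<epsilon> > 0"
    then obtain N where N: "\<And>n. n \<ge> N \<Longrightarrow> 1 / real (Suc n) < \<epsilon> / 2" using inv[of "\<epsilon>/2"] by auto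
    have "dB (b (f n)) (b (f n')) < \<epsilon>" if "N \<le> n" "N \<le> n'" for n n'
      using tri[of n n'] f[of n] f[of n'] N[OF that(1)] N[OF that(2)] eq by simp
    then show "\<exists>N. \<forall>n n'. N \<le> n \<longrightarrow> N \<le> n' \<longrightarrow> dB (b (f n)) (b (f n')) < \<epsilon>" by blast
  qed (use b in auto)
  then obtain y where y: "limitin B.mtopology (\<lambda>n. b (f n)) y sequentially"
    using B(2) unfolding B.mcomplete_def by blast
  then have yB: "y \<in> B" and conv: "\<And>\<epsilon>. \<epsilon> > 0 \<Longrightarrow> \<exists>N. \<forall>n\<ge>N. dB (b (f n)) y < \<epsilon>"
    unfolding B.limit_metric_sequentially by (blast, meson)
  have "dB y (b k) = dA x (p k)" for k
  proof (rule ccontr)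
    assume "dB y (b k) \<noteq> dA x (p k)"
    then have \<epsilon>: "\<bar>dB y (b k) - dA x (p k)\<bar> / 2 > 0" (is "?\<epsilon> > 0") by simp
    obtain N1 N2 where "\<forall>n\<ge>N1. dB (b (f n)) y < ?\<epsilon>" "\<forall>n\<ge>N2. 1 / real (Suc n) < ?\<epsilon>"
      using conv[OF \<epsilon>] inv[OF \<epsilon>] by blast
    then have n: "dB (b (f (N1 + N2))) y < ?\<epsilon>" "dA x (p (f (N1 + N2))) < ?\<epsilon>"
      using f[of "N1 + N2"] by (meson le_add1, meson le_add2 order.strict_trans)
    let ?n = "f (N1 + N2)"
    show False
      using n B.triangle[OF yB b[of ?n] b[of k]] B.triangle[OF b[of ?n] yB b[of k]] A.triangle[OF x p(1)[of ?n] p(1)[of k]]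
        A.triangle[OF p(1)[of ?n] x p(1)[of k]] eq[of ?n k] B.commute[of y "b ?n"] A.commute[of x "p ?n"] by argo
  qed
  then show ?thesis using yB by blast
qed

text \<open>A point is determined by its distances to a dense sequence. So the extension lemma gives
  the map in one direction, and applied in the other direction it gives preimages; uniform
  continuity carries the predicates along.\<close>

lemma iso_of_dense:
  fixes p :: "nat \<Rightarrow> 'a" and b :: "nat \<Rightarrow> 'b"
  assumes L: "signature_ok L" and M: "polish_structure L M" and N: "polish_structure L N"
    and p: "\<And>i. p i \<in> carrier M" "\<And>x s. x \<in> carrier M \<Longrightarrow> 0 < s \<Longrightarrow> \<exists>i. mdst M x (p i) < s"
    and b: "\<And>i. b i \<in> carrier N" "\<And>x s. x \<in> carrier N \<Longrightarrow> 0 < s \<Longrightarrow> \<exists>i. mdst N x (b i) < s"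
    and eq: "\<And>i j. mdst N (b i) (b j) = mdst M (p i) (p j)"
    and eqP: "\<And>q is. q \<in> Preds L \<Longrightarrow> length is = arity L q \<Longrightarrow> mpred N q (map b is) = mpred M q (map p is)"
  shows "iso_struc L M N"
proof -
  have M1: "Metric_space (carrier M) (mdst M)" "Metric_space.mcomplete (carrier M) (mdst M)" "metric_structure L M"
    using M by (auto simp: polish_structure_def metric_structure_def)
  have N1: "Metric_space (carrier N) (mdst N)" "Metric_space.mcomplete (carrier N) (mdst N)" "metric_structure L N"
    using N by (auto simp: polish_structure_def metric_structure_def)
  interpret A: Metric_space "carrier M" "mdst M" by fact
  interpret B: Metric_space "carrier N" "mdst N" by fact
  have uniq: "y = z" if h: "Metric_space Y d" "\<And>s. 0 < s \<Longrightarrow> \<exists>i. d y (w i) < s" "y \<in> Y" "z \<in> Y" "\<And>i. w i \<in> Y" "\<And>k. d y (w k) = d z (w k)"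
    for Y d y z and w :: "nat \<Rightarrow> 'c"
  proof (rule ccontr)
    interpret Y: Metric_space Y d by fact
    assume "y \<noteq> z"
    then have "d y z > 0" using h by simp
    then obtain i where "d y (w i) < d y z / 2" using h(2)[of "d y z / 2"] by auto
    then show False using Y.triangle[of y "w i" z] Y.commute[of "w i" z] h(3,4,5) h(6)[of i] by simp
  qed
  have "\<forall>x\<in>carrier M. \<exists>y\<in>carrier N. \<forall>k. mdst N y (b k) = mdst M x (p k)"
    using isometric_extension[OF M1(1) N1(1,2) p b(1) eq] by blast
  then obtain f where f: "\<And>x. x \<in> carrier M \<Longrightarrow> f x \<in> carrier N" "\<And>x k. x \<in> carrier M \<Longrightarrow> mdst N (f x) (b k) = mdst M x (p k)"
    by metis
  have surj: "\<exists>x\<in>carrier M. f x = y" if y: "y \<in> carrier N" for y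
  proof -
    obtain x where x: "x \<in> carrier M" "\<And>k. mdst M x (p k) = mdst N y (b k)"
      using isometric_extension[OF N1(1) M1(1,2) b p(1) eq[symmetric] y] by blast
    have "f x = y" by (rule uniq[OF N1(1), of _ b]) (use x f b y in auto)
    then show ?thesis using x by blast
  qed
  have isom: "mdst N (f x) (f y) = mdst M x y" if xy: "x \<in> carrier M" "y \<in> carrier M" for x y
  proof (rule ccontr)
    assume "mdst N (f x) (f y) \<noteq> mdst M x y"
    then have "\<bar>mdst N (f x) (f y) - mdst M x y\<bar> / 2 > 0" by simp
    then obtain k where "mdst M y (p k) < \<bar>mdst N (f x) (f y) - mdst M x y\<bar> / 2" using p(2) xy by blast
    then show False
      using f(2)[OF xy(1), of k] f(2)[OF xy(2), of k] A.triangle[OF xy p(1)[of k]] A.triangle[OF xy(1) p(1)[of k] xy(2)]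
        A.commute[of y "p k"] B.triangle[OF f(1)[OF xy(1)] f(1)[OF xy(2)] b(1)[of k]]
        B.triangle[OF f(1)[OF xy(1)] b(1)[of k] f(1)[OF xy(2)]] B.commute[of "f y" "b k"]
      by argo
  qed
  have inj: "inj_on f (carrier M)"
    using isom f(1) by (intro inj_onI) (metis A.zero B.zero)
  have pred: "mpred N q (map f as) = mpred M q as"
    if q: "q \<in> Preds L" "set as \<subseteq> carrier M" "length as = arity L q" for q as
  proof (rule ccontr)
    assume "mpred N q (map f as) \<noteq> mpred M q as"
    define \<epsilon> where "\<epsilon> = \<bar>mpred N q (map f as) - mpred M q as\<bar> / 3"
    have \<epsilon>: "\<epsilon> > 0" "\<bar>mpred N q (map f as) - mpred M q as\<bar> > 2 * \<epsilon>"
      using \<open>mpred N q (map f as) \<noteq> mpred M q as\<close> by (auto simp: \<epsilon>_def)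
    then have "modulus L q \<epsilon> > 0" using L q by (simp add: signature_ok_def)
    then have "\<forall>x\<in>carrier M. \<exists>i. mdst M x (p i) < modulus L q \<epsilon>" using p(2) by blast
    then obtain i where i: "\<And>x. x \<in> carrier M \<Longrightarrow> mdst M x (p (i x)) < modulus L q \<epsilon>" by metis
    let ?is = "map i as"
    have as: "as ! k \<in> carrier M" if "k < arity L q" for k using q that by (metis nth_mem subsetD)
    have UM: "\<bar>mpred M q u - mpred M q v\<bar> \<le> \<epsilon>" if "set u \<subseteq> carrier M" "set v \<subseteq> carrier M" "length u = arity L q" "length v = arity L q"
      "\<forall>k<arity L q. mdst M (u ! k) (v ! k) < modulus L q \<epsilon>" for u v
      using M1(3) q(1) \<epsilon>(1) that unfolding metric_structure_def by blast
    have UN: "\<bar>mpred N q u - mpred N q v\<bar> \<le> \<epsilon>" if "set u \<subseteq> carrier N" "set v \<subseteq> carrier N" "length u = arity L q" "length v = arity L q"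
      "\<forall>k<arity L q. mdst N (u ! k) (v ! k) < modulus L q \<epsilon>" for u v
      using N1(3) q(1) \<epsilon>(1) that unfolding metric_structure_def by blast
    have "\<bar>mpred M q as - mpred M q (map p ?is)\<bar> \<le> \<epsilon>"
      by (rule UM) (use q p(1) i as in auto)
    moreover have "\<bar>mpred N q (map f as) - mpred N q (map b ?is)\<bar> \<le> \<epsilon>"
      by (rule UN) (use q b(1) f i as in auto)
    moreover have "mpred N q (map b ?is) = mpred M q (map p ?is)" using q by (intro eqP) simp_all
    ultimately show False using \<epsilon> by linarith
  qed
  have "bij_betw f (carrier M) (carrier N)"
    unfolding bij_betw_def using inj f(1) surj by blast
  then show ?thesis unfolding iso_struc_def using isom pred by blast
qed

section \<open>Totally bounded balls in almost locally compact spaces\<close>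

text \<open>A point of the dense subspace \<open>D\<close> has a compact \<open>K\<close> containing
  \<open>V\<close> \<inter> \<open>D\<close> for some open \<open>V\<close> around it. Density of
  \<open>D\<close> puts \<open>V\<close> into the closure of this intersection, hence into the
  closed set \<open>K\<close>, so small balls in the whole space are totally bounded.\<close>

lemma locally_tb_dense:
  assumes M: "Metric_space (carrier M) (mdst M)" and alc: "almost_locally_compact (mtop M)"
    and e: "\<And>n. e n \<in> carrier M" "\<And>x s. x \<in> carrier M \<Longrightarrow> 0 < s \<Longrightarrow> \<exists>n::nat. mdst M x (e n) < s"
    and x: "x \<in> carrier M" "0 < s"
  shows "\<exists>n. mdst M x (e n) < s \<and> (\<exists>r>0. tb_ball (carrier M) (mdst M) (e n) r)"
proof -
  interpret Metric_space "carrier M" "mdst M" by fact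
  obtain D where D: "D \<subseteq> carrier M" "mtopology closure_of D = carrier M" "locally_compact_space (subtopology mtopology D)"
    using alc unfolding almost_locally_compact_def mtop_def by auto
  have "x \<in> mtopology closure_of D" using x D by simp
  then have "\<forall>r>0. \<exists>y\<in>D. y \<in> mball x r" unfolding metric_closure_of by simp
  moreover have "s / 2 > 0" using x by simp
  ultimately obtain z where "z \<in> D" "z \<in> mball x (s / 2)" by blast
  then have z: "z \<in> D" "mdst M x z < s / 2" "z \<in> carrier M" by auto
  then have "z \<in> topspace (subtopology mtopology D)" by simp
  then obtain U K where UK: "openin (subtopology mtopology D) U" "compactin (subtopology mtopology D) K" "z \<in> U" "U \<subseteq> K"
    using D(3) unfolding locally_compact_space_def by blast
  obtain V where V: "openin mtopology V" "U = V \<inter> D" using UK(1) by (auto simp: openin_subtopology)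
  have K: "compactin mtopology K" using UK(2) by (simp add: compactin_subtopology)
  have "V \<subseteq> carrier M" using V openin_subset by fastforce
  then have "V \<subseteq> mtopology closure_of U"
    using openin_Int_closure_of_subset[OF V(1), of D] D(2) V(2) by auto
  also have "\<dots> \<subseteq> K"
    using UK(4) K Hausdorff_space_mtopology compactin_imp_closedin closure_of_minimal by metis
  finally have VK: "V \<subseteq> K" .
  obtain r where r: "r > 0" "mball z r \<subseteq> V" using V UK(3) unfolding openin_mtopology by blast
  obtain n where n: "mdst M z (e n) < min (s / 2) (r / 2)" using e(2)[OF z(3), of "min (s/2) (r/2)"] x r by auto
  have "tb_ball (carrier M) (mdst M) (e n) (r / 2)" unfolding tb_ball_def
  proof (intro allI impI)
    fix t :: rat assume "t > 0"
    moreover have "mtotally_bounded K" using compactin_imp_mtotally_bounded K by blast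
    ultimately obtain F where F: "finite F" "F \<subseteq> K" "K \<subseteq> (\<Union>x\<in>F. mball x (of_rat t))"
      unfolding mtotally_bounded_def by (meson zero_less_of_rat_iff)
    then obtain Fs where Fs: "set Fs = F" using finite_list by blast
    show "\<exists>F. set F \<subseteq> carrier M \<and> (\<forall>y\<in>carrier M. mdst M y (e n) < r / 2 \<longrightarrow> (\<exists>f\<in>set F. mdst M y f < of_rat t))"
    proof (intro exI[of _ Fs] conjI ballI impI)
      show "set Fs \<subseteq> carrier M" using Fs F K compactin_subset_topspace by fastforce
      fix y assume y: "y \<in> carrier M" "mdst M y (e n) < r / 2"
      have "mdst M z y \<le> mdst M z (e n) + mdst M y (e n)" using triangle[of z "e n" y] commute[of y] y e z by simp
      then have "y \<in> mball z r" using n y z by simp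
      then have "y \<in> K" using r VK by blast
      then obtain f where "f \<in> F" "y \<in> mball f (of_rat t)" using F by blast
      then show "\<exists>f\<in>set Fs. mdst M y f < of_rat t" using Fs by (auto simp: commute)
    qed
  qed
  moreover have "mdst M x (e n) < s" using triangle[of x z "e n"] n z x e by auto
  ultimately show ?thesis using half_gt_zero[OF r(1)] by blast
qed

section \<open>Recovering an isomorphism\<close>

lemma (in pms) tb_ball_mono: "tb_ball X d x r \<Longrightarrow> s \<le> r \<Longrightarrow> tb_ball X d x s"
  unfolding tb_ball_def by (meson less_le_trans)

lemma (in pms) tb_ball_shift:
  assumes "tb_ball X d x r" "x \<in> X" "y \<in> X" "d x y + s \<le> r"
  shows "tb_ball X d y s"
proof -
  have "d z x < r" if "z \<in> X" "d z y < s" for z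
    using d_tri[of z y x] d_sym[of x y] assms that by simp
  then show ?thesis using assms(1) unfolding tb_ball_def by meson
qed

lemma link_rel_mono:
  "link_rel X d P (Near is js \<eta>) A B \<Longrightarrow> A' \<subseteq> A \<Longrightarrow> \<eta> \<le> \<theta> \<Longrightarrow> link_rel X d P (Near is js \<theta>) A' B"
  by (simp, meson less_le_trans subsetD)

text \<open>\<open>K n\<close> settles the first \<open>n\<close> coordinates up to (1/2)^n, while
  \<open>T n\<close> lies below every hit set numbered less than \<open>n\<close>. Their meet has
  both properties, since settling passes to smaller source sets.\<close>

lemma (in pms) settling_sequence:
  assumes e: "range e \<subseteq> X" and tb: "\<And>i. \<exists>r>0. tb_ball X d (e (p i)) r"
  shows "\<exists>C. (\<forall>n. hits e p (C n)) \<and>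
    (\<forall>S. hits e p S \<longrightarrow> (\<exists>N. \<forall>n\<ge>N. cyl_set X d P e (C n) \<subseteq> cyl_set X d P e S)) \<and>
    (\<forall>n S. hits e p S \<longrightarrow>
       link_rel X d P (Near [0..<n] [0..<n] ((1/2)^n)) (cyl_set X d P e (C n)) (cyl_set X d P e S))"
proof -
  let ?J = "cyl_set X d P e"
  have "\<exists>C. hits e p C \<and> (\<forall>S. hits e p S \<longrightarrow> link_rel X d P (Near [0..<n] [0..<n] ((1/2)^n)) (?J C) (?J S))" for n
  proof -
    obtain r where r: "\<And>i. r i > 0" "\<And>i. tb_ball X d (e (p i)) (r i)" using tb by metis
    \<comment> \<open>The 1 covers n = 0, where there are no radii. Division by 3 below fits the
      balls of radius 3\<eta> required by \<open>settle\<close>.\<close>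
    define m where "m = Min (insert 1 (r ` {..<n}))"
    have "m > 0" using r by (auto simp: m_def)
    then obtain \<theta> where \<theta>: "0 < real_of_rat \<theta>" "of_rat \<theta> < m / 3" using rat_between[of 0 "m / 3"] by auto
    define \<eta> where "\<eta> = min \<theta> ((1/2)^n / 2)"
    have \<eta>: "0 < \<eta>" "2 * \<eta> \<le> (1/2)^n" "\<eta> \<le> \<theta>" using \<theta> by (auto simp: \<eta>_def)
    have "tb_ball X d (e (p i)) (of_rat (3 * \<eta>))" if "i < n" for i
    proof (rule tb_ball_mono[OF r(2)])
      have "m \<le> r i" unfolding m_def using that by (intro Min_le) auto
      moreover have "(of_rat \<eta> :: real) \<le> of_rat \<theta>" using \<eta> by (simp add: of_rat_less_eq)
      ultimately show "of_rat (3 * \<eta>) \<le> r i" using \<theta> by (simp add: of_rat_mult)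
    qed
    then obtain C where "hits e p C" "\<And>S. hits e p S \<Longrightarrow> link_rel X d P (Near [0..<n] [0..<n] (2 * \<eta>)) (?J C) (?J S)"
      using settle[OF e \<eta>(1)] by meson
    then show ?thesis using link_rel_mono[OF _ subset_refl \<eta>(2)] by blast
  qed
  then obtain K where K: "\<And>n. hits e p (K n)"
    "\<And>n S. hits e p S \<Longrightarrow> link_rel X d P (Near [0..<n] [0..<n] ((1/2)^n)) (?J (K n)) (?J S)" by metis
  define T where "T = rec_nat (K 0) (\<lambda>n C. if hits e p (from_nat n) then Meet C (from_nat n) else C)"
  have T0: "T 0 = K 0" and TS: "T (Suc n) = (if hits e p (from_nat n) then Meet (T n) (from_nat n) else T n)" for n
    by (auto simp: T_def)
  have hT: "hits e p (T n)" for n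
    by (induction n) (auto simp: T0 TS K(1) intro: hits_Meet[OF e])
  have T_sub: "?J (T n) \<subseteq> ?J S" if "hits e p S" "to_nat S < n" for n S
    using that(2) by (induction n) (use that(1) in \<open>auto simp: TS less_Suc_eq\<close>)
  show ?thesis
  proof (intro exI[of _ "\<lambda>n. Meet (K n) (T n)"] conjI allI impI)
    fix n show "hits e p (Meet (K n) (T n))" using hits_Meet[OF e K(1) hT] .
  next
    fix S assume "hits e p S"
    then show "\<exists>N. \<forall>n\<ge>N. ?J (Meet (K n) (T n)) \<subseteq> ?J S"
      using T_sub by (intro exI[of _ "Suc (to_nat S)"]) (auto simp: Suc_le_eq)
  next
    fix n S assume "hits e p S"
    from link_rel_mono[OF K(2)[OF this] _ order_refl]
    show "link_rel X d P (Near [0..<n] [0..<n] ((1/2)^n)) (?J (Meet (K n) (T n))) (?J S)" by simp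
  qed
qed

lemma small_geometric:
  assumes "\<epsilon> > 0" shows "\<exists>N. \<forall>n\<ge>N. 2 * (1/2::real)^n < \<epsilon>"
proof -
  have "(\<lambda>n. 2 * (1/2::real)^n) \<longlonglongrightarrow> 2 * 0" by (intro tendsto_mult tendsto_const LIMSEQ_realpow_zero) auto
  then show ?thesis using assms by (simp add: order_tendsto_iff eventually_sequentially)
qed

lemma (in Metric_space) geometric_limit:
  assumes c: mcomplete and w: "\<And>n. n \<ge> k \<Longrightarrow> w n \<in> M" "\<And>n. n \<ge> k \<Longrightarrow> d (w n) (w (Suc n)) < (1/2)^n"
  shows "\<exists>y\<in>M. \<forall>n\<ge>k. d (w n) y \<le> 2 * (1/2)^n"
proof -
  \<comment> \<open>The subtracted tail of the geometric series closes the induction and later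
    yields a strict bound.\<close>
  have step: "d (w n) (w (n + m)) \<le> 2 * (1/2)^n - 2 * (1/2)^(n + m)" if n: "n \<ge> k" for n m
  proof (induction m)
    case 0 show ?case using w(1)[OF n] by simp
  next
    case (Suc m)
    have "d (w n) (w (n + Suc m)) \<le> d (w n) (w (n + m)) + d (w (n + m)) (w (Suc (n + m)))"
      using triangle[of "w n" "w (n + m)" "w (Suc (n + m))"] w(1) n by simp
    then show ?case using Suc w(2)[of "n + m"] n by simp
  qed
  have bound: "d (w n) (w m) < 2 * (1/2)^n" if "k \<le> n" "n \<le> m" for n m
  proof -
    have "0 < 2 * (1/2::real)^m" by simp
    moreover have "d (w n) (w m) \<le> 2 * (1/2)^n - 2 * (1/2)^m" using step[OF that(1), of "m - n"] that by simp
    ultimately show ?thesis by linarith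
  qed
  have "MCauchy (\<lambda>n. w (n + k))" unfolding MCauchy_def
  proof (intro conjI allI impI)
    fix \<epsilon> :: real assume "\<epsilon> > 0"
    then obtain N where N: "\<And>n. n \<ge> N \<Longrightarrow> 2 * (1/2::real)^n < \<epsilon>" using small_geometric by blast
    have "d (w (n + k)) (w (n' + k)) < \<epsilon>" if "N \<le> n" "N \<le> n'" for n n'
    proof (cases "n \<le> n'")
      case True then show ?thesis using bound[of "n + k" "n' + k"] N[of "n + k"] that by simp
    next
      case False
      then show ?thesis using bound[of "n' + k" "n + k"] N[of "n' + k"] that commute[of "w (n + k)"] by simp
    qed
    then show "\<exists>N. \<forall>n n'. N \<le> n \<longrightarrow> N \<le> n' \<longrightarrow> d (w (n + k)) (w (n' + k)) < \<epsilon>" by blast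
  qed (use w in auto)
  then obtain y where y: "limitin mtopology (\<lambda>n. w (n + k)) y sequentially" using c unfolding mcomplete_def by blast
  then have yM: "y \<in> M" unfolding limit_metric_sequentially by blast
  have conv: "\<exists>N. \<forall>n\<ge>N. d (w (n + k)) y < \<epsilon>" if "\<epsilon> > 0" for \<epsilon>
    using y that unfolding limit_metric_sequentially by meson
  have "d (w n) y \<le> 2 * (1/2)^n" if n: "n \<ge> k" for n
  proof (rule field_le_epsilon)
    fix \<epsilon> :: real assume "\<epsilon> > 0"
    then obtain N where N: "d (w (n + N + k)) y < \<epsilon>" using conv[of \<epsilon>] by (metis le_add2)
    then show "d (w n) y \<le> 2 * (1/2)^n + \<epsilon>"
      using bound[of n "n + N + k"] n triangle[of "w n" "w (n + N + k)" y] w(1) yM by simp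
  qed
  then show ?thesis using yM by blast
qed

section \<open>Transfer of conditions to a limit sequence\<close>

text \<open>\<open>y\<close> arises as a limit, so strict conditions may fail for \<open>y\<close>
  itself; what survives is that tuples arbitrarily close to \<open>y\<close> satisfy them. Density
  of \<open>y\<close> is not assumed, it is what has to be shown.\<close>

locale shadow_sequence = M: pms X d P + N: pms Y d' P'
  for X :: "'x set" and d P and Y :: "'y set" and d' P' +
  fixes x :: "nat \<Rightarrow> 'x" and y :: "nat \<Rightarrow> 'y"
  assumes x_mem: "x i \<in> X" and y_mem: "y i \<in> Y"
    and x_dense: "a \<in> X \<Longrightarrow> 0 < s \<Longrightarrow> \<exists>i. d a (x i) < s"
    and shadow: "map x [0..<l] \<in> cond_set X d P \<beta> \<Longrightarrow> 0 < \<epsilon> \<Longrightarrow>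
      \<exists>v\<in>cond_set Y d' P' \<beta>. k \<le> length v \<and> (\<forall>i<k. d' (v!i) (y i) < \<epsilon>)"
begin

lemma cond_set_mem: "v \<in> cond_set Y d' P' \<beta> \<Longrightarrow> i < length v \<Longrightarrow> v!i \<in> Y"
  using N.open_cond_set unfolding N.open_lists_def by (metis in_listsD nth_mem subsetD)

lemma x_lists: "map x l \<in> lists X" using x_mem by auto

text \<open>A rational strictly between two unequal distances would give a condition that holds for
  \<open>x\<close> but fails for every tuple sufficiently close to \<open>y\<close>.\<close>

lemma dist_eq: "d' (y i) (y j) = d (x i) (x j)"
proof -
  have v: "\<bar>d' (y i) (y j) - d' (v!i) (v!j)\<bar> < 2 * \<epsilon>"
    if "v \<in> cond_set Y d' P' \<beta>" "Suc (max i j) \<le> length v" "\<forall>k<Suc (max i j). d' (v!k) (y k) < \<epsilon>" for v \<beta> \<epsilon>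
  proof -
    have m: "v!i \<in> Y" "v!j \<in> Y" "d' (v!i) (y i) < \<epsilon>" "d' (v!j) (y j) < \<epsilon>"
      using that cond_set_mem[OF that(1)] by auto
    show ?thesis
      using m(3,4) N.d_tri[OF y_mem[of i] m(1) y_mem[of j]] N.d_tri[OF m(1,2) y_mem[of j]]
        N.d_tri[OF m(1) y_mem[of i] m(2)] N.d_tri[OF y_mem[of i] y_mem[of j] m(2)]
        N.d_sym[OF m(1) y_mem[of i]] N.d_sym[OF m(2) y_mem[of j]] by argo
  qed
  have "\<not> d (x i) (x j) < d' (y i) (y j)"
  proof
    assume "d (x i) (x j) < d' (y i) (y j)"
    then obtain t where t: "d (x i) (x j) < of_rat t" "of_rat t < d' (y i) (y j)" by (rule rat_between)
    have "map x [0..<Suc (max i j)] \<in> cond_set X d P (DistLt i j t)" using t x_lists by (auto simp del: upt_Suc)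
    from shadow[OF this, of "(d' (y i) (y j) - of_rat t) / 2" "Suc (max i j)"] t(2) obtain v where
      w: "v \<in> cond_set Y d' P' (DistLt i j t)" "Suc (max i j) \<le> length v" "\<forall>k<Suc (max i j). d' (v!k) (y k) < (d' (y i) (y j) - of_rat t) / 2"
      by auto
    have "d' (v!i) (v!j) < of_rat t" using w(1) by simp
    then show False using v[OF w] by argo
  qed
  moreover have "\<not> d (x i) (x j) > d' (y i) (y j)"
  proof
    assume "d' (y i) (y j) < d (x i) (x j)"
    then obtain t where t: "d' (y i) (y j) < of_rat t" "of_rat t < d (x i) (x j)" by (rule rat_between)
    have "map x [0..<Suc (max i j)] \<in> cond_set X d P (DistGt i j t)" using t x_lists by (auto simp del: upt_Suc)
    from shadow[OF this, of "(of_rat t - d' (y i) (y j)) / 2" "Suc (max i j)"] t(1) obtain v where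
      w: "v \<in> cond_set Y d' P' (DistGt i j t)" "Suc (max i j) \<le> length v" "\<forall>k<Suc (max i j). d' (v!k) (y k) < (of_rat t - d' (y i) (y j)) / 2"
      by auto
    have "d' (v!i) (v!j) > of_rat t" using w(1) by simp
    then show False using v[OF w] by argo
  qed
  ultimately show ?thesis by simp
qed

lemma pred_eq: "P' q (map y is) = P q (map x is)"
proof -
  define k where "k = Suc (Max (insert 0 (set is)))"
  have k: "i < k" if "i \<in> set is" for i using that by (simp add: k_def less_Suc_eq_le)
  have approx: "\<exists>v\<in>cond_set Y d' P' \<beta>. \<bar>P' q (map y is) - P' q (map ((!) v) is)\<bar> < \<epsilon>"
    if \<beta>: "map x [0..<k] \<in> cond_set X d P \<beta>" and \<epsilon>: "0 < \<epsilon>" for \<beta> \<epsilon>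
  proof -
    have "map y is \<in> lists Y" using y_mem by auto
    then obtain s where s: "s > 0" "\<And>ys. ys \<in> lists Y \<Longrightarrow> near d' s (map y is) ys \<Longrightarrow> \<bar>P' q (map y is) - P' q ys\<bar> < \<epsilon>"
      using N.P_cont[OF _ \<epsilon>] by meson
    obtain v where v: "v \<in> cond_set Y d' P' \<beta>" "k \<le> length v" "\<forall>i<k. d' (v!i) (y i) < s" using shadow[OF \<beta> s(1)] by blast
    have m: "v!i \<in> Y" if "i \<in> set is" for i using cond_set_mem[OF v(1)] v(2) k[OF that] by simp
    have "near d' s (map y is) (map ((!) v) is)"
      using v(3) k m N.d_sym[OF y_mem] by (auto simp: near_iff)
    then show ?thesis using v(1) s(2)[of "map ((!) v) is"] m by (auto simp: in_lists_conv_set)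
  qed
  have idx: "map ((!) (map x [0..<k])) is = map x is" using k by auto
  have "\<not> P q (map x is) < P' q (map y is)"
  proof
    assume "P q (map x is) < P' q (map y is)"
    then obtain t where t: "P q (map x is) < of_rat t" "of_rat t < P' q (map y is)" by (rule rat_between)
    have "map x [0..<k] \<in> cond_set X d P (PredLt q is t)" using t x_lists[of "[0..<k]"] k by (simp add: idx del: lists_image)
    from approx[OF this, of "P' q (map y is) - of_rat t"] t obtain v where
      "v \<in> cond_set Y d' P' (PredLt q is t)" "\<bar>P' q (map y is) - P' q (map ((!) v) is)\<bar> < P' q (map y is) - of_rat t" by auto
    then show False by auto
  qed
  moreover have "\<not> P' q (map y is) < P q (map x is)"
  proof
    assume "P' q (map y is) < P q (map x is)"
    then obtain t where t: "P' q (map y is) < of_rat t" "of_rat t < P q (map x is)" by (rule rat_between)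
    have "map x [0..<k] \<in> cond_set X d P (PredGt q is t)" using t x_lists[of "[0..<k]"] k by (simp add: idx del: lists_image)
    from approx[OF this, of "of_rat t - P' q (map y is)"] t obtain v where
      "v \<in> cond_set Y d' P' (PredGt q is t)" "\<bar>P' q (map y is) - P' q (map ((!) v) is)\<bar> < of_rat t - P' q (map y is)" by auto
    then show False by auto
  qed
  ultimately show ?thesis by simp
qed

text \<open>A net in \<open>Y\<close> shows only that finitely many \<open>y i\<close> approximate
  all others in the ball, which says nothing about \<open>z\<close>. By \<open>dist_eq\<close> the
  same holds for \<open>x\<close>, and as \<open>x\<close> is dense, finitely many
  \<open>x i\<close> cover a ball of \<open>X\<close>. \<open>Cover\<close> takes this back to
  \<open>Y\<close>, where it speaks of all points.\<close>

lemma tb_ball_covered: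
  assumes tb: "tb_ball Y d' (y l) r" and z: "z \<in> Y" "d' z (y l) < r" and s: "0 < s"
  shows "\<exists>k. d' z (y k) < s"
proof -
  obtain r2 where r2: "d' z (y l) < of_rat r2" "of_rat r2 < r" using z(2) by (rule rat_between)
  obtain r1 where r1: "d' z (y l) < of_rat r1" "real_of_rat r1 < of_rat r2" using r2(1) by (rule rat_between)
  have "0 < s / 2" using s by simp
  then obtain t where t: "0 < real_of_rat t" "of_rat t < s / 2" by (rule rat_between)
  then have t4: "0 < t / 4" by simp
  then obtain F where F: "set F \<subseteq> Y" "\<And>a. a \<in> Y \<Longrightarrow> d' a (y l) < r \<Longrightarrow> \<exists>f\<in>set F. d' a f < of_rat (t / 4)"
    using tb unfolding tb_ball_def by meson
  \<comment> \<open>The choice is meaningful only for net points close to some \<open>y i\<close>;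
    just those are reached below.\<close>
  define g where "g f = (SOME i. d' (y i) f < of_rat (t / 4))" for f
  define k where "k = Suc (Max (insert l (g ` set F)))"
  have gk: "g f < k" if "f \<in> set F" for f using that by (simp add: k_def less_Suc_eq_le)
  have lk: "l < k" by (simp add: k_def less_Suc_eq_le)
  \<comment> \<open>One quarter of \<open>t\<close> leads from \<open>a\<close> to some
    \<open>x i\<close>, two more through a net point to \<open>x (g f)\<close>; the last quarter is
    the strict slack in \<open>Cover\<close>.\<close>
  have "\<exists>i<k. d a (x i) < of_rat (3 * t / 4)" if a: "a \<in> X" "d a (x l) < of_rat r2" for a
  proof -
    have "0 < min (r - d a (x l)) (of_rat (t / 4))" using a(2) r2(2) t4 by simp
    then obtain i where i: "d a (x i) < min (r - d a (x l)) (of_rat (t / 4))" using x_dense[OF a(1)] by blast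
    have "d (x i) (x l) < r"
      using i M.d_tri[OF x_mem[of i] a(1) x_mem[of l]] M.d_sym[OF a(1) x_mem[of i]] by simp
    then have "d' (y i) (y l) < r" by (simp add: dist_eq)
    then obtain f where f: "f \<in> set F" "d' (y i) f < of_rat (t / 4)" using F(2) y_mem by blast
    have fY: "f \<in> Y" using f F by blast
    have g: "d' (y (g f)) f < of_rat (t / 4)" unfolding g_def by (rule someI[of _ i]) (rule f)
    have "d (x i) (x (g f)) = d' (y i) (y (g f))" by (simp add: dist_eq)
    also have "\<dots> < of_rat (t / 4) + of_rat (t / 4)"
      using g f(2) N.d_tri[OF y_mem[of i] fY y_mem[of "g f"]] N.d_sym[OF fY y_mem[of "g f"]] by simp
    finally have "d a (x (g f)) < of_rat (t / 4) + of_rat (t / 4) + of_rat (t / 4)"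
      using i M.d_tri[OF a(1) x_mem[of i] x_mem[of "g f"]] by simp
    then have "d a (x (g f)) < of_rat (3 * t / 4)" by (simp add: of_rat_divide of_rat_mult)
    then show ?thesis using gk[OF f(1)] by blast
  qed
  moreover have "r1 < r2" "3 * t / 4 < t" using r1(2) t(1) by (simp_all add: of_rat_less)
  ultimately have "\<exists>r' t'. r1 < r' \<and> t' < t \<and> (\<forall>a\<in>X. d a (x l) < of_rat r' \<longrightarrow> (\<exists>i<k. d a (x i) < of_rat t'))"
    by blast
  then have "map x [0..<k] \<in> cond_set X d P (Cover k l r1 t)"
    using x_lists[of "[0..<k]"] lk by (simp del: lists_image cong: conj_cong)
  moreover define \<epsilon> where "\<epsilon> = min (of_rat r1 - d' z (y l)) (s / 2)"
  moreover have "\<epsilon> > 0" using r1 s by (simp add: \<epsilon>_def)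
  ultimately obtain v where v: "v \<in> cond_set Y d' P' (Cover k l r1 t)" "k \<le> length v" "\<forall>i<k. d' (v!i) (y i) < \<epsilon>"
    using shadow by blast
  then obtain r' t' where c: "r1 < r'" "t' < t" "\<And>a. a \<in> Y \<Longrightarrow> d' a (v!l) < of_rat r' \<Longrightarrow> \<exists>i<k. d' a (v!i) < of_rat t'" by auto
  have vY: "v!i \<in> Y" if "i < k" for i using cond_set_mem[OF v(1)] v(2) that by simp
  have "d' z (v!l) < of_rat r1"
    using N.d_tri[OF z(1) y_mem[of l] vY[OF lk]] v(3) lk N.d_sym[OF vY[OF lk] y_mem[of l]] by (fastforce simp: \<epsilon>_def)
  also have "\<dots> < real_of_rat r'" using c by (simp add: of_rat_less)
  finally obtain i where i: "i < k" "d' z (v!i) < of_rat t'" using c z by blast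
  have "(of_rat t' :: real) < of_rat t" using c by (simp add: of_rat_less)
  then have "d' z (y i) < of_rat t + \<epsilon>"
    using N.d_tri[OF z(1) vY[OF i(1)] y_mem[of i]] i v(3) by fastforce
  also have "\<dots> \<le> s" using t by (simp add: \<epsilon>_def)
  finally show ?thesis by blast
qed

end

section \<open>From an isomorphism of invariants to an isomorphism of structures\<close>

lemma invariant_reflects:
  assumes L: "signature_ok L" and cM: "codes L c M e" and cN: "codes L c' N e'"
    and alcM: "almost_locally_compact (mtop M)" and alcN: "almost_locally_compact (mtop N)"
    and iso: "ctbl_iso (\<lambda>_. 2) (invariant c) (invariant c')"
  shows "iso_struc L M N"
proof -
  interpret a: dense_pms "carrier M" "mdst M" "total_pred L M" e using codes_dense L cM .
  interpret b: dense_pms "carrier N" "mdst N" "total_pred L N" e' using codes_dense L cN .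
  have polM: "polish_structure L M" and polN: "polish_structure L N" using cM cN by (auto simp: codes_def)
  then have msM: "Metric_space (carrier M) (mdst M)" and msN: "Metric_space (carrier N) (mdst N)"
    by (auto simp: polish_structure_def metric_structure_def)
  interpret N: Metric_space "carrier N" "mdst N" by fact
  have compl: N.mcomplete using polN by (simp add: polish_structure_def)
  let ?lM = "link_rel (carrier M) (mdst M) (total_pred L M)"
  let ?lN = "link_rel (carrier N) (mdst N) (total_pred L N)"
  obtain \<pi> where \<pi>: "bij \<pi>" "\<And>r xs. length xs = 2 \<Longrightarrow> invariant c (r, xs) = invariant c' (r, map \<pi> xs)"
    using iso unfolding ctbl_iso_def by blast
  have link: "?lM \<rho> (a.J (expr i)) (a.J (expr j)) \<longleftrightarrow> ?lN \<rho> (b.J (expr (\<pi> i))) (b.J (expr (\<pi> j)))" for \<rho> i j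
    using \<pi>(2)[of "[i, j]" "to_nat \<rho>"]
    unfolding invariant_def codes_eq[OF cM] codes_eq[OF cN] by (simp add: a.link_trace b.link_trace)
  \<comment> \<open>Only the empty set lies in the closure of an unsatisfiable condition, so
    emptiness is expressible by a link.\<close>
  have emp: "?lM (InCl (DistLt 0 0 (-1))) A B \<longleftrightarrow> A = {}" "?lN (InCl (DistLt 0 0 (-1))) A' B' \<longleftrightarrow> A' = {}" for A B A' B'
  proof -
    have "cond_set (carrier M) (mdst M) (total_pred L M) (DistLt 0 0 (-1)) = {}"
      "cond_set (carrier N) (mdst N) (total_pred L N) (DistLt 0 0 (-1)) = {}"
      using msM by (auto simp: Metric_space.nonneg not_less intro: order_trans[of _ 0])
    then show "?lM (InCl (DistLt 0 0 (-1))) A B \<longleftrightarrow> A = {}" "?lN (InCl (DistLt 0 0 (-1))) A' B' \<longleftrightarrow> A' = {}"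
      by (auto simp del: cond_set.simps dest: spec[of _ "1::rat"])
  qed
  have nonempty: "a.J (expr i) = {} \<longleftrightarrow> b.J (expr (\<pi> i)) = {}" for i
    using link[of "InCl (DistLt 0 0 (-1))" i i] emp by simp

  define Q where "Q = {n. \<exists>r>0. tb_ball (carrier M) (mdst M) (e n) r}"
  define q where "q = from_nat_into Q"
  define x where "x = (\<lambda>i. e (q i))"
  have Q_dense: "\<exists>n\<in>Q. mdst M z (e n) < s" if "z \<in> carrier M" "0 < s" for z s
    using locally_tb_dense[OF msM alcM a.e_mem a.e_dense that] by (auto simp: Q_def)
  then have "Q \<noteq> {}" using a.e_mem[of 0] by (metis empty_iff zero_less_one)
  then have qQ: "q i \<in> Q" for i unfolding q_def by (rule from_nat_into)
  have x_mem: "x i \<in> carrier M" for i by (simp add: x_def a.e_mem)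
  have x_dense: "\<exists>i. mdst M z (x i) < s" if z: "z \<in> carrier M" "0 < s" for z s
  proof -
    obtain n where n: "n \<in> Q" "mdst M z (e n) < s" using Q_dense z by blast
    obtain i where "q i = n" using from_nat_into_surj[OF _ n(1)] by (auto simp: q_def)
    then show ?thesis using n by (auto simp: x_def)
  qed
  have eM: "range e \<subseteq> carrier M" using a.e_mem by auto
  have tbq: "\<exists>r>0. tb_ball (carrier M) (mdst M) (e (q i)) r" for i using qQ[of i] by (simp add: Q_def)
  have seg: "a.seg e q l = map x [0..<l]" for l by (simp add: a.seg_def x_def)
  obtain C where C: "\<And>n. a.hits e q (C n)"
    "\<And>S. a.hits e q S \<Longrightarrow> \<exists>N. \<forall>n\<ge>N. a.J (C n) \<subseteq> a.J S"
    "\<And>n S. a.hits e q S \<Longrightarrow> ?lM (Near [0..<n] [0..<n] ((1/2)^n)) (a.J (C n)) (a.J S)"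
    using a.settling_sequence[where p = q, OF eM tbq] by blast
  have "\<forall>n. \<exists>i. expr i = C n" using expr_surj by blast
  then obtain i where i: "\<And>n. expr (i n) = C n" by metis
  define D where "D n = expr (\<pi> (i n))" for n
  have linkD: "?lM \<rho> (a.J (C n)) (a.J (expr j)) \<longleftrightarrow> ?lN \<rho> (b.J (D n)) (b.J (expr (\<pi> j)))" for \<rho> n j
    using link[of \<rho> "i n" j] by (simp add: i D_def)

  have long: "\<exists>w. u @ w \<in> b.J S \<and> n \<le> length (u @ w)" if "u \<in> b.J S" for u S n
    using b.cyl_set_append[OF that, of "replicate n (e' 0)"] b.e_mem
    by (intro exI[of _ "replicate n (e' 0)"]) (auto simp: in_lists_conv_set)
  \<comment> \<open>\<open>D (Suc n)\<close> need not be contained in \<open>D n\<close>. The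
    transported settling link still gives a next tuple whose first \<open>n\<close> entries have
    moved by less than (1/2)^n.\<close>
  have "\<exists>u. \<forall>n. (u n \<in> b.J (D n) \<and> n \<le> length (u n)) \<and> near (mdst N) ((1/2)^n) (take n (u n)) (take n (u (Suc n)))"
  proof (rule dependent_nat_choice)
    have "a.J (C 0) \<noteq> {}" using C(1)[of 0] by (auto simp: a.hits_def)
    then have "b.J (D 0) \<noteq> {}" using nonempty[of "i 0"] by (simp add: i D_def)
    then show "\<exists>u. u \<in> b.J (D 0) \<and> 0 \<le> length u" by auto
  next
    fix u n assume u: "u \<in> b.J (D n) \<and> n \<le> length u"
    have "?lN (Near [0..<n] [0..<n] ((1/2)^n)) (b.J (D n)) (b.J (D (Suc n)))"
      using C(3)[OF C(1), of n "Suc n"] linkD[of _ n "i (Suc n)"] by (simp add: i D_def del: link_rel.simps)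
    then obtain h v where h: "h < (1/2)^n" and v: "v \<in> b.J (D (Suc n))" "\<forall>j\<in>set [0..<n]. j < length v"
      "near (mdst N) (of_rat h) (map ((!) u) [0..<n]) (map ((!) v) [0..<n])"
      using u by fastforce
    have "n \<le> length v" using v(2) by (cases "n \<le> length v") (auto dest: bspec[of _ _ "length v"])
    have "real_of_rat h \<le> of_rat ((1/2)^n)" using h by (simp add: of_rat_less_eq)
    then have "real_of_rat h \<le> (1/2)^n" by (simp add: of_rat_power of_rat_divide)
    then have n: "near (mdst N) ((1/2)^n) (take n u) (take n v)"
      using near_mono[OF v(3)] u \<open>n \<le> length v\<close> by (simp add: take_eq_map_nth)
    obtain w where "v @ w \<in> b.J (D (Suc n))" "Suc n \<le> length (v @ w)" using long[OF v(1)] by blast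
    then show "\<exists>v. (v \<in> b.J (D (Suc n)) \<and> Suc n \<le> length v) \<and> near (mdst N) ((1/2)^n) (take n u) (take n v)"
      using n \<open>n \<le> length v\<close> by (intro exI[of _ "v @ w"]) simp
  qed
  then obtain u where u: "\<And>n. u n \<in> b.J (D n)" "\<And>n. n \<le> length (u n)"
    "\<And>n. near (mdst N) ((1/2)^n) (take n (u n)) (take n (u (Suc n)))" by blast
  have u_mem: "u n ! j \<in> carrier N" if "j < n" for n j
    using b.cyl_set_lists[OF u(1)[of n]] u(2)[of n] that by (auto simp: in_lists_conv_set)
  \<comment> \<open>Coordinate \<open>j\<close> is controlled only from stage \<open>j\<close> + 1
    on, when it belongs to the first \<open>n\<close> entries.\<close>
  have "\<exists>y\<in>carrier N. \<forall>n\<ge>Suc j. mdst N (u n ! j) y \<le> 2 * (1/2)^n" for j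
  proof (rule N.geometric_limit[OF compl])
    fix n assume n: "Suc j \<le> n"
    show "u n ! j \<in> carrier N" using u_mem n by simp
    show "mdst N (u n ! j) (u (Suc n) ! j) < (1/2)^n"
      using u(3)[of n] u(2)[of n] u(2)[of "Suc n"] n unfolding near_iff by (auto dest!: spec[of _ j])
  qed
  then obtain y where y_mem: "\<And>j. y j \<in> carrier N" and y: "\<And>j n. j < n \<Longrightarrow> mdst N (u n ! j) (y j) \<le> 2 * (1/2)^n"
    by (metis Suc_leI)
  have small: "\<exists>n\<ge>m. 2 * (1/2::real)^n < \<epsilon>" if "\<epsilon> > 0" for \<epsilon> m
    using small_geometric[OF that] by (meson max.cobounded1 max.cobounded2)

  interpret shadow_sequence "carrier M" "mdst M" "total_pred L M" "carrier N" "mdst N" "total_pred L N" x y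
  proof
    fix l \<beta> k and \<epsilon> :: real
    assume l: "map x [0..<l] \<in> cond_set (carrier M) (mdst M) (total_pred L M) \<beta>" and \<epsilon>: "0 < \<epsilon>"
    then have "a.hits e q (Basic \<beta>)" by (auto simp: a.hits_def seg)
    then obtain m where m: "\<And>n. n \<ge> m \<Longrightarrow> a.J (C n) \<subseteq> cond_set (carrier M) (mdst M) (total_pred L M) \<beta>" using C(2) by fastforce
    obtain n where n: "n \<ge> max m k" "2 * (1/2::real)^n < \<epsilon> / 2" using small[of "\<epsilon>/2" "max m k"] \<epsilon> by auto
    \<comment> \<open>\<open>InCl\<close> acts as a unary predicate here. After transport it says
      only that \<open>D n\<close> lies in the closure of the condition, which is why a nearby tuple
      \<open>v\<close> replaces \<open>u n\<close>.\<close>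
    have "?lM (InCl \<beta>) (a.J (C n)) (a.J (C n))" unfolding link_rel.simps
    proof (intro ballI allI impI)
      fix w and s :: rat assume "w \<in> a.J (C n)" "0 < s"
      then show "\<exists>v\<in>cond_set (carrier M) (mdst M) (total_pred L M) \<beta>. near (mdst M) (of_rat s) w v"
        using m[of n] n a.near_refl[OF a.cyl_set_lists, of w] by (intro bexI[of _ w]) auto
    qed
    then have in_cl: "?lN (InCl \<beta>) (b.J (D n)) (b.J (D n))" using linkD[of "InCl \<beta>" n "i n"] by (simp add: i D_def del: link_rel.simps)
    have "0 < \<epsilon> / 2" using \<epsilon> by simp
    then obtain s where s: "0 < real_of_rat s" "of_rat s < \<epsilon> / 2" by (rule rat_between)
    then obtain v where v: "v \<in> cond_set (carrier N) (mdst N) (total_pred L N) \<beta>" "near (mdst N) (of_rat s) (u n) v"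
      using in_cl u(1)[of n] by auto
    have len: "length v = length (u n)" using near_length[OF v(2)] by simp
    show "\<exists>v\<in>cond_set (carrier N) (mdst N) (total_pred L N) \<beta>. k \<le> length v \<and> (\<forall>i<k. mdst N (v ! i) (y i) < \<epsilon>)"
    proof (intro bexI[OF _ v(1)] conjI allI impI)
      show "k \<le> length v" using len u(2)[of n] n by simp
      fix j assume j: "j < k"
      have jn: "j < n" "j < length (u n)" using j n u(2)[of n] by auto
      have vj: "v ! j \<in> carrier N"
        using v(1) b.open_cond_set[of \<beta>] jn len unfolding b.open_lists_def by (metis in_listsD nth_mem subsetD)
      have "mdst N (u n ! j) (v ! j) < of_rat s" using v(2) jn by (simp add: near_iff)
      then show "mdst N (v ! j) (y j) < \<epsilon>"
        using N.triangle[OF vj u_mem[OF jn(1)] y_mem[of j]] N.commute[of "v ! j" "u n ! j"] y[OF jn(1)] n s by simp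
    qed
  qed (use x_mem y_mem x_dense in auto)

  define Z where "Z = {z \<in> carrier N. \<forall>s>0. \<exists>k. mdst N z (y k) < s}"
  \<comment> \<open>Moving the centre from \<open>t\<close> to \<open>y k\<close> leaves a totally
    bounded ball of radius 7R/8, and \<open>z\<close> is within R/2 + R/8 of
    \<open>y k\<close>.\<close>
  have spread: "z \<in> Z"
    if R: "0 < (R::real)" and t: "t \<in> carrier N" "tb_ball (carrier N) (mdst N) t R" "mdst N t (y k) < R / 8"
      and z: "z \<in> carrier N" "mdst N z t < R / 2" for R t k z
  proof -
    have "tb_ball (carrier N) (mdst N) (y k) (7 * R / 8)"
      by (rule b.tb_ball_shift[OF t(2,1) y_mem]) (use t in simp)
    moreover have "mdst N z (y k) < 7 * R / 8" using N.triangle[OF z(1) t(1) y_mem[of k]] t(3) z(2) R by simp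
    ultimately show ?thesis using tb_ball_covered z(1) by (simp add: Z_def)
  qed
  have e'_Z: "e' m \<in> Z" if tb: "0 < r" "tb_ball (carrier N) (mdst N) (e' m) r" for m r
  proof -
    obtain R where R: "0 < real_of_rat R" "of_rat R < r" using tb(1) by (rule rat_between)
    obtain R' where R': "real_of_rat R < of_rat R'" "of_rat R' < r" using R(2) by (rule rat_between)
    define T where "T = Basic (TotBdd 0 R)"
    have T: "[t] \<in> b.J T \<Longrightarrow> tb_ball (carrier N) (mdst N) t (of_rat R)" for t
      using b.tb_ball_mono by (auto simp: T_def of_rat_less_eq dest!: order_less_imp_le)
    have "tb_ball (carrier N) (mdst N) (e' m) (of_rat R')" by (rule b.tb_ball_mono[OF tb(2)]) (use R' in simp)
    then have mT: "[e' m] \<in> b.J T" using R'(1) b.e_mem by (auto simp: T_def of_rat_less)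
    have D_mem: "[e' m] \<in> b.J (Chain T (R/2) [m])" using mT R(1) b.e_mem by simp
    \<comment> \<open>Surjectivity of \<open>\<pi>\<close> provides a canonical set of
      \<open>M\<close> for this component; it is known to be nonempty, but not to be a
      component.\<close>
    obtain j0 where "expr j0 = Chain T (R/2) [m]" using expr_surj by blast
    moreover obtain j where "\<pi> j = j0" using \<pi>(1) by (metis bij_pointE)
    ultimately have j: "expr (\<pi> j) = Chain T (R/2) [m]" by simp
    then have "a.J (expr j) \<noteq> {}" using nonempty[of j] D_mem by (metis empty_iff)
    then obtain w where w: "w \<in> a.J (expr j)" by blast
    have "w @ [e 0] \<in> a.J (expr j)" using a.cyl_set_append[OF w, of "[e 0]"] a.e_mem by simp
    then obtain z zs where zs: "z # zs \<in> a.J (expr j)" by (cases "w @ [e 0]") auto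
    then have zX: "z \<in> carrier M" "zs \<in> lists (carrier M)" using a.cyl_set_lists[OF zs] by auto
    obtain s where s: "s > 0" "\<And>v. v \<in> lists (carrier M) \<Longrightarrow> near (mdst M) s (z # zs) v \<Longrightarrow> v \<in> a.J (expr j)"
      using a.open_listsD[OF a.open_cyl_set zs] by blast
    obtain k where k: "mdst M z (x k) < s" using x_dense[OF zX(1) s(1)] by blast
    have "x k # zs \<in> a.J (expr j)"
      by (rule s(2)) (use k zX x_mem a.near_refl[OF zX(2) s(1)] in \<open>auto simp: near_def\<close>)
    \<comment> \<open>Openness and density of \<open>x\<close> allow \<open>x k\<close> as first
      entry, so \<open>x\<close> itself hits the set pulled to position \<open>k\<close>.\<close>
    then have "map x [0..<Suc k] \<in> a.J (Pull k (expr j))"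
      using x_mem by (auto simp del: upt_Suc intro!: bexI[of _ "x k # zs"])
    then have "a.hits e q (Pull k (expr j))" unfolding a.hits_def seg by blast
    then obtain n0 where n0: "\<And>n. n \<ge> n0 \<Longrightarrow> a.J (C n) \<subseteq> a.J (Pull k (expr j))" using C(2) by blast
    obtain n where n: "n \<ge> max n0 (Suc k)" "2 * (1/2::real)^n < of_rat R / 16" using small[of "of_rat R / 16" "max n0 (Suc k)"] R by auto
    \<comment> \<open>One R/16 from this link and one from the limit bound make up the R/8 needed in
      \<open>spread\<close>.\<close>
    have "?lM (Near [k] [0] (R / 16)) (a.J (C n)) (a.J (expr j))" unfolding link_rel.simps
    proof (intro exI[of _ "R / 32"] conjI ballI impI)
      fix v assume "v \<in> a.J (C n)"
      then have "v \<in> a.J (Pull k (expr j))" using n0[of n] n by auto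
      then obtain v' where v': "k < length v" "v \<in> lists (carrier M)" "v' \<in> a.J (expr j)" "v' \<noteq> []" "hd v' = v ! k" by auto
      then have "v ! k \<in> carrier M" by (auto simp: in_lists_conv_set)
      then show "\<exists>v'\<in>a.J (expr j). (\<forall>j\<in>set [0]. j < length v') \<and> near (mdst M) (of_rat (R / 32)) (map ((!) v) [k]) (map ((!) v') [0])"
        using v' R(1) a.d_refl by (intro bexI[of _ v']) (auto simp: near_def hd_conv_nth[symmetric])
    qed (use R in simp)
    then have "?lN (Near [k] [0] (R / 16)) (b.J (D n)) (b.J (Chain T (R/2) [m]))" using linkD[of _ n j] j by (simp del: link_rel.simps)
    moreover have kn: "k < n" "k < length (u n)" using n u(2)[of n] by auto
    ultimately obtain h v where h: "h < R / 16" and v: "v \<in> b.J (Chain T (R/2) [m])" "0 < length v" "mdst N (u n ! k) (v ! 0) < of_rat h"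
      using u(1)[of n] by (fastforce simp: near_def)
    have v0: "v ! 0 \<in> carrier N" using b.cyl_set_lists[OF v(1)] v(2) by (auto simp: in_lists_conv_set)
    have "real_of_rat h < of_rat (R / 16)" using h by (simp add: of_rat_less)
    then have "mdst N (u n ! k) (v ! 0) < of_rat R / 16" using v(3) by (simp add: of_rat_divide)
    then have near_y: "mdst N (v ! 0) (y k) < of_rat R / 8"
      using N.triangle[OF v0 u_mem[OF kn(1)] y_mem[of k]] N.commute[of "v ! 0" "u n ! k"] y[OF kn(1)] n(2) by simp
    let ?R = "{(s, t). s \<in> b.J T \<and> t \<in> b.J T \<and> near (mdst N) (of_rat (R/2)) s t}"
    have "take 1 v = [v ! 0]" using v(2) by (cases v) auto
    then have "([e' m], [v ! 0]) \<in> ?R\<^sup>*" using v(1) by simp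
    \<comment> \<open>The chain is followed backwards to \<open>e' m\<close>. Its tuples have length
      1, its steps are shorter than R/2 and all its points lie in \<open>T\<close>, so
      \<open>spread\<close> applies at each step with the same R.\<close>
    then have "\<exists>t. [e' m] = [t] \<and> (\<exists>k. mdst N t (y k) < of_rat R / 8)"
    proof (induction rule: converse_rtrancl_induct)
      case base then show ?case using near_y by blast
    next
      case (step s t)
      then obtain t' k where t': "t = [t']" "mdst N t' (y k) < of_rat R / 8" by blast
      then obtain s' where s': "s = [s']" "mdst N s' t' < of_rat (R/2)"
        using step(1) by (auto simp: near_def list_all2_Cons2)
      have mem: "s' \<in> carrier N" "t' \<in> carrier N" using step(1) b.cyl_set_lists t' s' by force+
      have "s' \<in> Z"
        using spread[OF R(1) mem(2) T t'(2) mem(1)] step(1) t' s' by (simp add: of_rat_divide)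
      moreover have "0 < real_of_rat R / 8" using R(1) by simp
      ultimately show ?case using s'(1) unfolding Z_def by blast
    qed
    then obtain k' where "mdst N (e' m) (y k') < of_rat R / 8" by blast
    then show ?thesis using spread[OF R(1) b.e_mem T[OF mT] _ b.e_mem, of k'] R(1) b.d_refl[OF b.e_mem] by simp
  qed
  have y_dense: "\<exists>k. mdst N z (y k) < s" if z: "z \<in> carrier N" "0 < s" for z s
  proof -
    have "0 < s / 2" using z by simp
    then obtain m r where m: "mdst N z (e' m) < s / 2" "r > 0" "tb_ball (carrier N) (mdst N) (e' m) r"
      using locally_tb_dense[OF msN alcN b.e_mem b.e_dense z(1)] by blast
    then obtain k where "mdst N (e' m) (y k) < s / 2" using e'_Z[OF m(2,3)] \<open>0 < s / 2\<close> unfolding Z_def by blast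
    then show ?thesis using m N.triangle[OF z(1) b.e_mem[of m] y_mem[of k]] by (intro exI[of _ k]) simp
  qed
  show ?thesis
  proof (rule iso_of_dense[OF L polM polN x_mem x_dense y_mem y_dense dist_eq])
    fix p and "is" :: "nat list" assume "p \<in> Preds L" "length is = arity L p"
    then show "mpred N p (map y is) = mpred M p (map x is)" using pred_eq[of p "is"] by (simp add: total_pred_def)
  qed
qed

theorem theorem3p6:
  fixes L :: signature and F T :: "form set"
  assumes "signature_ok L"
    and "fragment L F"
    and "T \<subseteq> F" and "\<forall>\<phi>\<in>T. sentence \<phi>"
    and "\<forall>M :: univ mstruc. polish_structure L M \<and> models M T
           \<longrightarrow> almost_locally_compact (mtop M)"
  shows "classifiable_by_countable_structures
           (restrict_space (borel :: code measure) (Mod_T L T)) (iso_T L T)"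
  unfolding classifiable_by_countable_structures_def
proof (intro exI[of _ "\<lambda>_. 2"] exI[of _ invariant] conjI ballI)
  show "invariant \<in> measurable (restrict_space borel (Mod_T L T)) (PiM UNIV (\<lambda>_. count_space UNIV))"
    using invariant_meas by (rule measurable_restrict_space1)
next
  fix c c' assume "c \<in> space (restrict_space borel (Mod_T L T))" "c' \<in> space (restrict_space borel (Mod_T L T))"
  then have c: "c \<in> Mod_T L T" and c': "c' \<in> Mod_T L T" by (auto simp: space_restrict_space)
  show "iso_T L T c c' \<longleftrightarrow> ctbl_iso (\<lambda>_. 2) (invariant c) (invariant c')"
  proof
    assume "iso_T L T c c'"
    \<comment> \<open>This direction holds for arbitrary codes; almost local compactness serves the
      converse.\<close>
    then show "ctbl_iso (\<lambda>_. 2) (invariant c) (invariant c')"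
      using invariant_iso[OF assms(1)] unfolding iso_T_def by blast
  next
    assume i: "ctbl_iso (\<lambda>_. 2) (invariant c) (invariant c')"
    obtain M :: "univ mstruc" and e where M: "codes L c M e" "models M T" using c by (auto simp: Mod_T_def)
    obtain N :: "univ mstruc" and e' where N: "codes L c' N e'" "models N T" using c' by (auto simp: Mod_T_def)
    have "almost_locally_compact (mtop M)" "almost_locally_compact (mtop N)"
      using assms(5) M N by (auto simp: codes_def)
    from invariant_reflects[OF assms(1) M(1) N(1) this i] show "iso_T L T c c'"
      unfolding iso_T_def using c c' M(1) N(1) by blast
  qed
qed

end
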